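(* Let $r,c\in\mathbb{R}^n$ be vectors with positive entries each summing to one, let $A\in\mathbb{R}^{n\times n}$ have strictly positive entries, let $s=\sum_{ij}A_{ij}$, $\ell=\min_{ij}A_{ij}$, and let $\varepsilon'>0$. Then the $\textsc{Greenkhorn}$ algorithm (described in the context) outputs a matrix $B$ satisfying $\|r(B)-r\|_1+\|c(B)-c\|_1\le\varepsilon'$ in $O\big(n(\varepsilon')^{-2}\log(s/\ell)\big)$ iterations. Since each iteration can be implemented in $O(n)$ time, such a matrix can be found in $O\big(n^2(\varepsilon')^{-2}\log(s/\ell)\big)$ time.
   Context: For $M\in\mathbb{R}^{n\times n}$, $r(M)=M\mathbf{1}$, $c(M)=M^\top\mathbf{1}$ with coordinates $r_i(M)$, $c_j(M)$; $\|M\|_1=\sum_{ij}|M_{ij}|$; $\mathbf{D}(x)$ is the diagonal matrix with diagonal $x$; $\exp$ of a vector is entrywise. Define $\rho:\mathbb{R}_+\times\mathbb{R}_+\to[0,+\infty]$ by $\rho(a,b)=b-a+a\log\frac ab$. The $\textsc{Greenkhorn}(A,\mathcal{U}_{r,c},\varepsilon')$ algorithm: set $A^{(0)}=A/\|A\|_1$, $x=y=\mathbf{0}\in\mathbb{R}^n$, and current matrix $A'=A^{(0)}$. While $\|r(A')-r\|_1+\|c(A')-c\|_1>\varepsilon'$ (one iteration per pass): let $I\in\arg\max_i\rho(r_i,r_i(A'))$ and $J\in\arg\max_j\rho(c_j,c_j(A'))$; if $\rho(r_I,r_I(A'))>\rho(c_J,c_J(A'))$, set $x_I\leftarrow x_I+\log\frac{r_I}{r_I(A')}$,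 otherwise set $y_J\leftarrow y_J+\log\frac{c_J}{c_J(A')}$; then set $A'=\mathbf{D}(\exp(x))A^{(0)}\mathbf{D}(\exp(y))$. Output $B=A'$.
   Formalization: The O(n²ε'⁻²log(s/ℓ)) time bound fails for n=1 (log(s/ℓ)=0) and as ε'→∞; it is proved for n≥2 and ε' bounded above by any fixed ε₀ (constant depending on ε₀), and for all inputs with an additional n² term. The iteration bound is literal. *)

theory Defs
  imports
    Complex_Main
    "HOL-Library.Extended_Real"
    "Jordan_Normal_Form.Matrix"
begin

section \<open>The Greenkhorn algorithm\<close>

text \<open>The constants hidden in the O-notation must not depend on the dimension, so the dimension is
  a natural number bound inside the statement, and vectors and matrices are carrier-based.\<close>

definition row_sums :: "real mat \<Rightarrow> real vec" where
  "row_sums M = M *\<^sub>v vec (dim_col M) (\<lambda>_. 1)"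

definition col_sums :: "real mat \<Rightarrow> real vec" where
  "col_sums M = transpose_mat M *\<^sub>v vec (dim_row M) (\<lambda>_. 1)"

definition vec_norm1 :: "real vec \<Rightarrow> real" where
  "vec_norm1 v = (\<Sum>i<dim_vec v. \<bar>v $ i\<bar>)"

definition mat_norm1 :: "real mat \<Rightarrow> real" where
  "mat_norm1 M = (\<Sum>i<dim_row M. \<Sum>j<dim_col M. \<bar>M $$ (i, j)\<bar>)"

definition entry_sum :: "real mat \<Rightarrow> real" where
  "entry_sum M = (\<Sum>i<dim_row M. \<Sum>j<dim_col M. M $$ (i, j))"

definition min_entry :: "real mat \<Rightarrow> real" where
  "min_entry M = Min (elements_mat M)"

text \<open>Intended for nonnegative arguments. With \<open>0 log 0 = 0\<close> the only infinite values are those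
  with \<open>a > 0\<close> and \<open>b = 0\<close>, where HOL's \<open>ln (a / 0) = ln 0 = 0\<close> would give the wrong value.\<close>

definition rho :: "real \<Rightarrow> real \<Rightarrow> ereal" where
  "rho a b = (if a > 0 \<and> b = 0 then \<infinity> else ereal (b - a + a * ln (a / b)))"

definition marginal_error :: "real vec \<Rightarrow> real vec \<Rightarrow> real mat \<Rightarrow> real" where
  "marginal_error r c M = vec_norm1 (row_sums M - r) + vec_norm1 (col_sums M - c)"

definition greenkhorn_input ::
  "nat \<Rightarrow> real vec \<Rightarrow> real vec \<Rightarrow> real mat \<Rightarrow> real \<Rightarrow> bool" where
  "greenkhorn_input n r c A \<epsilon> \<longleftrightarrow>
     r \<in> carrier_vec n \<and> (\<forall>i<n. r $ i > 0) \<and> (\<Sum>i<n. r $ i) = 1 \<and>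
     c \<in> carrier_vec n \<and> (\<forall>j<n. c $ j > 0) \<and> (\<Sum>j<n. c $ j) = 1 \<and>
     A \<in> carrier_mat n n \<and> (\<forall>i<n. \<forall>j<n. A $$ (i, j) > 0) \<and>
     \<epsilon> > 0"

type_synonym scaling_state = "real vec \<times> real vec"

definition current_matrix :: "nat \<Rightarrow> real mat \<Rightarrow> scaling_state \<Rightarrow> real mat" where
  "current_matrix n A = (\<lambda>(x, y).
     mat_diag n (\<lambda>i. exp (x $ i)) * ((1 / mat_norm1 A) \<cdot>\<^sub>m A) * mat_diag n (\<lambda>j. exp (y $ j)))"

text \<open>A relation rather than a function, because ties in the two maximizations may be broken
  arbitrarily.\<close>

definition greenkhorn_step ::
  "nat \<Rightarrow> real vec \<Rightarrow> real vec \<Rightarrow> real mat \<Rightarrow> scaling_state \<Rightarrow> scaling_state \<Rightarrow> bool" where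
  "greenkhorn_step n r c A = (\<lambda>(x, y) (x', y').
     let R = row_sums (current_matrix n A (x, y));
         K = col_sums (current_matrix n A (x, y))
     in \<exists>I J.
          is_arg_max (\<lambda>i. rho (r $ i) (R $ i)) (\<lambda>i. i < n) I \<and>
          is_arg_max (\<lambda>j. rho (c $ j) (K $ j)) (\<lambda>j. j < n) J \<and>
          (if rho (r $ I) (R $ I) > rho (c $ J) (K $ J)
           then x' = (x |\<^sub>v I \<mapsto> x $ I + ln (r $ I / R $ I)) \<and> y' = y
           else x' = x \<and> y' = (y |\<^sub>v J \<mapsto> y $ J + ln (c $ J / K $ J))))"

text \<open>A run is an infinite sequence of states in which nothing is required once the loop condition
  has failed. The number of iterations is the first index at which it fails.\<close>

definition greenkhorn_run ::
  "nat \<Rightarrow> real vec \<Rightarrow> real vec \<Rightarrow> real mat \<Rightarrow> real \<Rightarrow> (nat \<Rightarrow> scaling_state) \<Rightarrow> bool" where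
  "greenkhorn_run n r c A \<epsilon> st \<longleftrightarrow>
     st 0 = (0\<^sub>v n, 0\<^sub>v n) \<and>
     (\<forall>m. (\<forall>l\<le>m. marginal_error r c (current_matrix n A (st l)) > \<epsilon>) \<longrightarrow>
          greenkhorn_step n r c A (st m) (st (Suc m)))"

definition greenkhorn_output ::
  "nat \<Rightarrow> real vec \<Rightarrow> real vec \<Rightarrow> real mat \<Rightarrow> real \<Rightarrow> (nat \<Rightarrow> scaling_state) \<Rightarrow> nat \<Rightarrow> real mat \<Rightarrow> bool"
where
  "greenkhorn_output n r c A \<epsilon> st k B \<longleftrightarrow>
     (\<forall>l<k. marginal_error r c (current_matrix n A (st l)) > \<epsilon>) \<and>
     \<not> marginal_error r c (current_matrix n A (st k)) > \<epsilon> \<and>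
     B = current_matrix n A (st k)"

section \<open>Running time: programs on a real RAM\<close>

text \<open>Time is counted in the real-number model: exact reals, with every arithmetic operation,
  comparison, memory access, exponential and logarithm at unit cost. The only data are natural
  number registers, used as array indices, and real arrays with two indices; vectors use second
  index 0 and scalars use cell \<open>(0, 0)\<close>. Literals are natural numbers and integers, so that no
  real number can be hard-wired into a program.
  Partial operations take HOL's default values outside their domain.\<close>

record ram_state =
  reg :: "string \<Rightarrow> nat"
  mem :: "string \<Rightarrow> nat \<Rightarrow> nat \<Rightarrow> real"

datatype nexp = NLit nat | NReg string | NAdd nexp nexp

datatype rexp =
    RLit int
  | Cell string nexp nexp
  | RAdd rexp rexp
  | RSub rexp rexp
  | RMul rexp rexp
  | RDiv rexp rexp
  | RExp rexp
  | RLog rexp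

datatype bexp = RLess rexp rexp | NLess nexp nexp | BNot bexp | BAnd bexp bexp

datatype com =
    CSkip
  | CSetReg string nexp
  | CSetCell string nexp nexp rexp
  | CSeq com com
  | CIf bexp com com
  | CWhile bexp com

primrec nval :: "nexp \<Rightarrow> ram_state \<Rightarrow> nat" where
  "nval (NLit k) s = k"
| "nval (NReg v) s = reg s v"
| "nval (NAdd a b) s = nval a s + nval b s"

primrec ncost :: "nexp \<Rightarrow> nat" where
  "ncost (NLit k) = 1"
| "ncost (NReg v) = 1"
| "ncost (NAdd a b) = 1 + ncost a + ncost b"

primrec rval :: "rexp \<Rightarrow> ram_state \<Rightarrow> real" where
  "rval (RLit k) s = of_int k"
| "rval (Cell v a b) s = mem s v (nval a s) (nval b s)"
| "rval (RAdd a b) s = rval a s + rval b s"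
| "rval (RSub a b) s = rval a s - rval b s"
| "rval (RMul a b) s = rval a s * rval b s"
| "rval (RDiv a b) s = rval a s / rval b s"
| "rval (RExp a) s = exp (rval a s)"
| "rval (RLog a) s = ln (rval a s)"

primrec rcost :: "rexp \<Rightarrow> nat" where
  "rcost (RLit k) = 1"
| "rcost (Cell v a b) = 1 + ncost a + ncost b"
| "rcost (RAdd a b) = 1 + rcost a + rcost b"
| "rcost (RSub a b) = 1 + rcost a + rcost b"
| "rcost (RMul a b) = 1 + rcost a + rcost b"
| "rcost (RDiv a b) = 1 + rcost a + rcost b"
| "rcost (RExp a) = 1 + rcost a"
| "rcost (RLog a) = 1 + rcost a"

primrec bval :: "bexp \<Rightarrow> ram_state \<Rightarrow> bool" where
  "bval (RLess a b) s \<longleftrightarrow> rval a s < rval b s"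
| "bval (NLess a b) s \<longleftrightarrow> nval a s < nval b s"
| "bval (BNot b) s \<longleftrightarrow> \<not> bval b s"
| "bval (BAnd a b) s \<longleftrightarrow> bval a s \<and> bval b s"

primrec bcost :: "bexp \<Rightarrow> nat" where
  "bcost (RLess a b) = 1 + rcost a + rcost b"
| "bcost (NLess a b) = 1 + ncost a + ncost b"
| "bcost (BNot b) = 1 + bcost b"
| "bcost (BAnd a b) = 1 + bcost a + bcost b"

text \<open>\<open>exec p s t s'\<close>: started in \<open>s\<close>, program \<open>p\<close> terminates in \<open>s'\<close> after \<open>t\<close> operations.\<close>

inductive exec :: "com \<Rightarrow> ram_state \<Rightarrow> nat \<Rightarrow> ram_state \<Rightarrow> bool" where
  Skip: "exec CSkip s 1 s"
| SetReg: "exec (CSetReg v a) s (1 + ncost a) (s\<lparr>reg := (reg s)(v := nval a s)\<rparr>)"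
| SetCell: "exec (CSetCell v a b e) s (1 + ncost a + ncost b + rcost e)
    (s\<lparr>mem := (mem s)(v := (mem s v)(nval a s := (mem s v (nval a s))(nval b s := rval e s)))\<rparr>)"
| Seq: "exec p s t s' \<Longrightarrow> exec q s' u s'' \<Longrightarrow> exec (CSeq p q) s (t + u) s''"
| IfTrue: "bval b s \<Longrightarrow> exec p s t s' \<Longrightarrow> exec (CIf b p q) s (bcost b + t) s'"
| IfFalse: "\<not> bval b s \<Longrightarrow> exec q s t s' \<Longrightarrow> exec (CIf b p q) s (bcost b + t) s'"
| WhileFalse: "\<not> bval b s \<Longrightarrow> exec (CWhile b p) s (bcost b) s"
| WhileTrue: "bval b s \<Longrightarrow> exec p s t s' \<Longrightarrow> exec (CWhile b p) s' u s'' \<Longrightarrow>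
    exec (CWhile b p) s (bcost b + t + u) s''"

inductive_cases exec_SkipE: "exec CSkip s t s'"
inductive_cases exec_SetRegE: "exec (CSetReg v a) s t s'"
inductive_cases exec_SetCellE: "exec (CSetCell v a b e) s t s'"
inductive_cases exec_SeqE: "exec (CSeq p q) s t s'"
inductive_cases exec_IfE: "exec (CIf b p q) s t s'"
inductive_cases exec_WhileE: "exec (CWhile b p) s t s'"

text \<open>Running time and final state are determined by program and initial state, so an existentially
  quantified running time denotes the running time of the program.\<close>

lemma exec_deterministic:
  "exec p s t s' \<Longrightarrow> exec p s u s'' \<Longrightarrow> u = t \<and> s'' = s'"
proof (induction arbitrary: u s'' rule: exec.induct)
  case (Seq p s t s' q v s1)
  from Seq.prems obtain t' u' s2 where "exec p s t' s2" "exec q s2 u' s''" "u = t' + u'"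
    by (rule exec_SeqE)
  with Seq.IH show ?case by metis
next
  case (IfTrue b s p t s' q)
  from IfTrue.prems obtain t' where "exec p s t' s''" "u = bcost b + t'"
    using IfTrue.hyps by (cases rule: exec_IfE) auto
  with IfTrue.IH show ?case by metis
next
  case (IfFalse b s q t s' p)
  from IfFalse.prems obtain t' where "exec q s t' s''" "u = bcost b + t'"
    using IfFalse.hyps by (cases rule: exec_IfE) auto
  with IfFalse.IH show ?case by metis
next
  case (WhileFalse b s p)
  from WhileFalse.prems show ?case
    using WhileFalse.hyps by (cases rule: exec_WhileE) auto
next
  case (WhileTrue b s p t s' v s1)
  from WhileTrue.prems obtain t' u' s2
    where "exec p s t' s2" "exec (CWhile b p) s2 u' s''" "u = bcost b + t' + u'"
    using WhileTrue.hyps by (cases rule: exec_WhileE) auto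
  with WhileTrue.IH show ?case by metis
qed (auto elim: exec_SkipE exec_SetRegE exec_SetCellE)

definition start_state ::
  "nat \<Rightarrow> real vec \<Rightarrow> real vec \<Rightarrow> real mat \<Rightarrow> real \<Rightarrow> ram_state" where
  "start_state n r c A \<epsilon> = \<lparr>
     reg = (\<lambda>_. 0)(''n'' := n),
     mem = (\<lambda>_ _ _. 0)(
       ''A'' := (\<lambda>i j. if i < n \<and> j < n then A $$ (i, j) else 0),
       ''r'' := (\<lambda>i j. if i < n \<and> j = 0 then r $ i else 0),
       ''c'' := (\<lambda>i j. if i < n \<and> j = 0 then c $ i else 0),
       ''eps'' := (\<lambda>i j. if i = 0 \<and> j = 0 then \<epsilon> else 0))\<rparr>"

definition holds_matrix :: "ram_state \<Rightarrow> string \<Rightarrow> real mat \<Rightarrow> bool" where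
  "holds_matrix s v M \<longleftrightarrow> (\<forall>i<dim_row M. \<forall>j<dim_col M. mem s v i j = M $$ (i, j))"

definition holds_vector :: "ram_state \<Rightarrow> string \<Rightarrow> real vec \<Rightarrow> bool" where
  "holds_vector s v x \<longleftrightarrow> (\<forall>i<dim_vec x. mem s v i 0 = x $ i)"

definition holds_scaling_state :: "nat \<Rightarrow> real mat \<Rightarrow> ram_state \<Rightarrow> scaling_state \<Rightarrow> bool" where
  "holds_scaling_state n A s = (\<lambda>(x, y).
     holds_vector s ''x'' x \<and> holds_vector s ''y'' y \<and>
     holds_matrix s ''B'' (current_matrix n A (x, y)))"

text \<open>The program \<open>init; while guard do body\<close> carries out the run \<open>st\<close>, executing the loop exactly
  \<open>k\<close> times and passing through the memory contents \<open>\<sigma> 0, \<dots>, \<sigma> k\<close>. Setting up takes at most \<open>T0\<close>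
  operations and every iteration, including the test of the guard, at most \<open>T1\<close>.\<close>

definition carries_out ::
  "com \<Rightarrow> bexp \<Rightarrow> com \<Rightarrow> nat \<Rightarrow> real vec \<Rightarrow> real vec \<Rightarrow> real mat \<Rightarrow> real \<Rightarrow>
   (nat \<Rightarrow> scaling_state) \<Rightarrow> nat \<Rightarrow> real \<Rightarrow> real \<Rightarrow> (nat \<Rightarrow> ram_state) \<Rightarrow> bool" where
  "carries_out init guard body n r c A \<epsilon> st k T0 T1 \<sigma> \<longleftrightarrow>
     (\<exists>t. exec init (start_state n r c A \<epsilon>) t (\<sigma> 0) \<and> real t \<le> T0) \<and>
     (\<forall>m\<le>k. holds_scaling_state n A (\<sigma> m) (st m)) \<and>
     (\<forall>m<k. bval guard (\<sigma> m) \<and>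
        (\<exists>t. exec body (\<sigma> m) t (\<sigma> (Suc m)) \<and> real (bcost guard + t) \<le> T1)) \<and>
     \<not> bval guard (\<sigma> k)"

end

theory Submission
  imports Defs
begin

text \<open>
  The potential \<open>\<Sum>\<^sub>i\<^sub>j A'\<^sub>i\<^sub>j - \<langle>r, x\<rangle> - \<langle>c, y\<rangle>\<close> starts at \<open>1\<close>, never falls below \<open>1 - ln (s / \<ell>)\<close>,
  and drops in each iteration by exactly the maximal \<open>\<rho>\<close>, hence by at least the average of \<open>\<rho>\<close> over
  the \<open>2n\<close> rows and columns. Since \<open>\<rho> a b \<ge> (\<surd>a - \<surd>b)\<^sup>2\<close>, the sum of all \<open>\<rho>\<close> is at least \<open>\<epsilon>\<^sup>2 / 16\<close>
  while the marginal error exceeds \<open>\<epsilon>\<close>, provided \<open>\<epsilon> \<le> 4\<close>. For larger \<open>\<epsilon>\<close> the loop is never entered,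
  the initial error being at most \<open>4\<close>.

  An iteration takes \<open>O(n)\<close> operations because it changes a single row or column of the matrix, so
  stored row and column sums can be corrected entry by entry.
\<close>

section \<open>Number of iterations\<close>

lemma current_matrix_index:
  assumes "A \<in> carrier_mat n n" "i < n" "j < n"
  shows "current_matrix n A (x, y) $$ (i, j) = exp (x $ i) * (A $$ (i, j) / mat_norm1 A) * exp (y $ j)"
proof -
  let ?B = "(1 / mat_norm1 A) \<cdot>\<^sub>m A"
  have B: "?B \<in> carrier_mat n n" using assms by auto
  have DB: "mat_diag n (\<lambda>i. exp (x $ i)) * ?B \<in> carrier_mat n n"
    using B by (rule mult_carrier_mat[OF mat_diag_dim])
  show ?thesis
    unfolding current_matrix_def prod.case mat_diag_mult_right[OF DB]
    using assms by (simp add: mat_diag_mult_left[OF B])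
qed

lemma current_matrix_carrier [simp]: "current_matrix n A (x, y) \<in> carrier_mat n n"
  by (auto simp: current_matrix_def mat_diag_def)

lemma dim_current_matrix [simp]:
  "dim_row (current_matrix n A s) = n" "dim_col (current_matrix n A s) = n"
  using current_matrix_carrier[of n A "fst s" "snd s"] by auto

lemma dim_row_sums [simp]: "dim_vec (row_sums M) = dim_row M"
  by (simp add: row_sums_def)

lemma dim_col_sums [simp]: "dim_vec (col_sums M) = dim_col M"
  by (simp add: col_sums_def)

lemma row_sums_index: "i < dim_row M \<Longrightarrow> row_sums M $ i = (\<Sum>j<dim_col M. M $$ (i, j))"
  by (simp add: row_sums_def scalar_prod_def atLeast0LessThan)

lemma col_sums_index: "j < dim_col M \<Longrightarrow> col_sums M $ j = (\<Sum>i<dim_row M. M $$ (i, j))"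
  by (simp add: col_sums_def scalar_prod_def atLeast0LessThan)

lemma marginal_error_eq:
  assumes "r \<in> carrier_vec n" "c \<in> carrier_vec n" "M \<in> carrier_mat n n"
  shows "marginal_error r c M =
    (\<Sum>i<n. \<bar>row_sums M $ i - r $ i\<bar> + \<bar>col_sums M $ i - c $ i\<bar>)"
  using assms by (simp add: marginal_error_def vec_norm1_def sum.distrib)

lemma update_vec_carrier [simp]: "v \<in> carrier_vec n \<Longrightarrow> (v |\<^sub>v i \<mapsto> a) \<in> carrier_vec n"
  unfolding carrier_dim_vec by (simp only: dim_update_vec)

text \<open>Serves both sides of the development: a single row or column sum changes in the
  potential argument, and a single entry changes when the stored sums are corrected.\<close>

lemma sum_change_one:
  fixes f g :: "nat \<Rightarrow> real"
  assumes "I < n" "\<And>i. i < n \<Longrightarrow> i \<noteq> I \<Longrightarrow> g i = f i"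
  shows "(\<Sum>i<n. g i) = (\<Sum>i<n. f i) + (g I - f I)"
proof -
  have "(\<Sum>i\<in>{..<n} - {I}. g i) = (\<Sum>i\<in>{..<n} - {I}. f i)"
    using assms by (intro sum.cong) auto
  then show ?thesis
    using assms(1) by (simp add: sum.remove[of "{..<n}" I])
qed

section \<open>Comparing \<open>rho\<close> with the absolute difference\<close>

lemma rho_pos: "b > 0 \<Longrightarrow> rho a b = ereal (b - a + a * ln (a / b))"
  by (simp add: rho_def)

text \<open>With \<open>h\<close> the distance of the square roots, the logarithmic inequality at
  \<open>v / u\<close> bounds \<open>h\<close> squared by the divergence, and
  \<open>h * (u + v)\<close> is at most \<open>h\<close> squared plus \<open>2 * h * u\<close>.
  Splitting the cross term with the parameter \<open>t\<close> leaves an error linear in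
  \<open>a\<close>, which sums to \<open>t\<close> over a probability vector.\<close>

lemma abs_diff_le_rho:
  fixes a b t :: real
  assumes "a > 0" "b > 0" "t > 0"
  shows "\<bar>a - b\<bar> \<le> (1 + 1 / t) * (b - a + a * ln (a / b)) + t * a"
proof -
  define u v where "u = sqrt a" and "v = sqrt b"
  have uv: "u > 0" "v > 0" "a = u\<^sup>2" "b = v\<^sup>2"
    using assms by (auto simp: u_def v_def)
  define h where "h = \<bar>u - v\<bar>"
  have "ln (v / u) \<le> v / u - 1"
    using uv by (intro ln_le_minus_one) auto
  then have "2 * u\<^sup>2 * (ln v - ln u) \<le> 2 * u\<^sup>2 * (v / u - 1)"
    using uv by (intro mult_left_mono) (auto simp: ln_div)
  also have "\<dots> = 2 * u * v - 2 * u\<^sup>2"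
    using uv by (simp add: field_simps power2_eq_square)
  finally have "h\<^sup>2 \<le> b - a + a * ln (a / b)"
    using uv by (simp add: h_def ln_div ln_realpow algebra_simps power2_diff)
  then have "(1 + 1 / t) * h\<^sup>2 \<le> (1 + 1 / t) * (b - a + a * ln (a / b))"
    using assms by (intro mult_left_mono) auto
  moreover have "\<bar>a - b\<bar> \<le> (1 + 1 / t) * h\<^sup>2 + t * a"
  proof -
    have "a - b = (u - v) * (u + v)"
      using uv by (simp add: algebra_simps power2_eq_square)
    then have "\<bar>a - b\<bar> = h * (u + v)"
      using uv by (simp add: h_def abs_mult)
    also have "\<dots> \<le> h * (2 * u + h)"
      by (intro mult_left_mono) (auto simp: h_def)
    also have "\<dots> = h\<^sup>2 + 2 * h * u"
      by (simp add: algebra_simps power2_eq_square)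
    \<comment> \<open>Weighted arithmetic-geometric mean inequality, from expanding the square of
      \<open>h - t * u\<close>.\<close>
    also have "2 * h * u \<le> h\<^sup>2 / t + t * u\<^sup>2"
    proof -
      have "0 \<le> (h - t * u)\<^sup>2 / t" using assms by simp
      also have "\<dots> = h\<^sup>2 / t + t * u\<^sup>2 - 2 * h * u"
        using assms by (simp add: power2_diff field_simps power2_eq_square)
      finally show ?thesis by simp
    qed
    finally show ?thesis using uv by (simp add: algebra_simps)
  qed
  ultimately show ?thesis by linarith
qed

section \<open>Positivity and size of a fixed input\<close>

locale greenkhorn =
  fixes n :: nat and r c :: "real vec" and A :: "real mat" and \<epsilon> :: real
  assumes input: "greenkhorn_input n r c A \<epsilon>"
begin

lemma
  shows r_carrier: "r \<in> carrier_vec n" and r_pos: "\<And>i. i < n \<Longrightarrow> r $ i > 0"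
    and r_sum: "(\<Sum>i<n. r $ i) = 1"
    and c_carrier: "c \<in> carrier_vec n" and c_pos: "\<And>j. j < n \<Longrightarrow> c $ j > 0"
    and c_sum: "(\<Sum>j<n. c $ j) = 1"
    and A_carrier: "A \<in> carrier_mat n n" and A_pos: "\<And>i j. i < n \<Longrightarrow> j < n \<Longrightarrow> A $$ (i, j) > 0"
    and eps_pos: "\<epsilon> > 0"
  using input by (auto simp: greenkhorn_input_def)

lemma n_pos: "n > 0"
  using r_sum by (cases n) auto

lemma mat_norm1_A: "mat_norm1 A = entry_sum A"
  using A_carrier A_pos by (auto simp: mat_norm1_def entry_sum_def abs_of_pos intro!: sum.cong)

lemma entry_sum_A: "entry_sum A = (\<Sum>i<n. \<Sum>j<n. A $$ (i, j))"
  using A_carrier by (auto simp: entry_sum_def)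

lemma entry_sum_pos: "entry_sum A > 0"
  unfolding entry_sum_A using n_pos A_pos by (intro sum_pos) auto

lemma finite_elements: "finite (elements_mat A)"
  and elements_nonempty: "elements_mat A \<noteq> {}"
  using n_pos A_carrier by (auto simp: elements_mat_def)

lemma min_entry_le: "i < n \<Longrightarrow> j < n \<Longrightarrow> min_entry A \<le> A $$ (i, j)"
  unfolding min_entry_def using A_carrier finite_elements
  by (intro Min_le) auto

lemma min_entry_pos: "min_entry A > 0"
proof -
  have "min_entry A \<in> elements_mat A"
    unfolding min_entry_def using finite_elements elements_nonempty by (rule Min_in)
  then show ?thesis
    using A_carrier A_pos by (auto simp: elements_mat_def)
qed

lemma entry_sum_ge: "(real n)\<^sup>2 * min_entry A \<le> entry_sum A"
proof -
  have "(\<Sum>i<n. \<Sum>j<n. min_entry A) \<le> entry_sum A"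
    unfolding entry_sum_A using min_entry_le by (intro sum_mono) auto
  then show ?thesis by (simp add: power2_eq_square)
qed

abbreviation "L \<equiv> ln (entry_sum A / min_entry A)"

abbreviation M where "M \<equiv> current_matrix n A"

abbreviation "rs s \<equiv> row_sums (M s)"

abbreviation "cs s \<equiv> col_sums (M s)"

lemma M_index:
  "i < n \<Longrightarrow> j < n \<Longrightarrow> M (x, y) $$ (i, j) = exp (x $ i) * (A $$ (i, j) / entry_sum A) * exp (y $ j)"
  using current_matrix_index[OF A_carrier] by (simp add: mat_norm1_A)

lemma rs_index: "i < n \<Longrightarrow> rs s $ i = (\<Sum>j<n. M s $$ (i, j))"
  and cs_index: "j < n \<Longrightarrow> cs s $ j = (\<Sum>i<n. M s $$ (i, j))"
  by (auto simp: row_sums_index col_sums_index)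

lemma M_pos: "i < n \<Longrightarrow> j < n \<Longrightarrow> M s $$ (i, j) > 0"
  using A_pos entry_sum_pos by (cases s) (simp add: M_index)

lemma rs_pos: "i < n \<Longrightarrow> rs s $ i > 0"
  unfolding rs_index using n_pos M_pos by (intro sum_pos) auto

lemma cs_pos: "j < n \<Longrightarrow> cs s $ j > 0"
  unfolding cs_index using n_pos M_pos by (intro sum_pos) auto

text \<open>All \<open>n\<close> squared entries are at least the minimum, so the ratio inside the
  logarithm is at least \<open>n\<close> squared. Besides nonnegativity this yields
  \<open>L >= 1\<close> for \<open>n >= 2\<close>, which later lets the iterations pay for the
  setup.\<close>

lemma L_ge: "2 * ln (real n) \<le> L"
proof -
  have "(real n)\<^sup>2 \<le> entry_sum A / min_entry A"
    using entry_sum_ge min_entry_pos by (simp add: field_simps)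
  then have "ln ((real n)\<^sup>2) \<le> L"
    using n_pos by (intro ln_mono) auto
  then show ?thesis
    using n_pos by (simp add: ln_realpow)
qed

lemma L_nonneg: "0 \<le> L"
proof -
  have "0 \<le> ln (real n)" using n_pos by (simp add: ln_ge_zero)
  then show ?thesis using L_ge by linarith
qed

section \<open>The potential and its bounds\<close>

definition potential :: "scaling_state \<Rightarrow> real" where
  "potential = (\<lambda>(x, y). (\<Sum>i<n. \<Sum>j<n. M (x, y) $$ (i, j))
     - (\<Sum>i<n. r $ i * x $ i) - (\<Sum>j<n. c $ j * y $ j))"

lemma potential_start: "potential (0\<^sub>v n, 0\<^sub>v n) = 1"
proof -
  have "(\<Sum>i<n. \<Sum>j<n. M (0\<^sub>v n, 0\<^sub>v n) $$ (i, j)) = (\<Sum>i<n. \<Sum>j<n. A $$ (i, j)) / entry_sum A"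
    by (simp add: M_index sum_divide_distrib)
  then show ?thesis
    using entry_sum_pos entry_sum_A by (simp add: potential_def)
qed

text \<open>Each entry is at least \<open>exp (x\<^sub>i + y\<^sub>j - L)\<close>, hence at least
  \<open>r\<^sub>i c\<^sub>j (1 + x\<^sub>i + y\<^sub>j - L)\<close>, and these bounds average to \<open>1 - L + \<langle>r, x\<rangle> + \<langle>c, y\<rangle>\<close>.\<close>

lemma potential_lower: "1 - L \<le> potential s"
proof -
  obtain x y where s: "s = (x, y)" by (cases s)
  have rc1: "r $ i \<le> 1" "c $ i \<le> 1" if "i < n" for i
    using that member_le_sum[of i "{..<n}" "\<lambda>i. r $ i"] member_le_sum[of i "{..<n}" "\<lambda>i. c $ i"]
      r_pos c_pos r_sum c_sum by (auto simp: less_imp_le)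
  have entry: "r $ i * c $ j * (1 + (x $ i + y $ j - L)) \<le> M (x, y) $$ (i, j)"
    if ij: "i < n" "j < n" for i j
  proof -
    let ?z = "x $ i + y $ j - L"
    have "r $ i * c $ j * (1 + ?z) \<le> r $ i * c $ j * exp ?z"
      using r_pos[OF ij(1)] c_pos[OF ij(2)] exp_ge_add_one_self[of ?z]
      by (intro mult_left_mono) auto
    also have "\<dots> \<le> 1 * exp ?z"
      using rc1 ij r_pos c_pos by (intro mult_right_mono mult_le_one) (auto simp: less_imp_le)
    also have "exp ?z = exp (x $ i) * (min_entry A / entry_sum A) * exp (y $ j)"
      using min_entry_pos entry_sum_pos by (simp add: exp_diff exp_add)
    also have "\<dots> \<le> M (x, y) $$ (i, j)"
      using min_entry_le[OF ij] entry_sum_pos ij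
      by (simp add: M_index divide_right_mono)
    finally show ?thesis by simp
  qed
  have "(\<Sum>i<n. \<Sum>j<n. r $ i * c $ j * (1 + (x $ i + y $ j - L)))
      = (\<Sum>i<n. \<Sum>j<n. (1 - L) * (r $ i * c $ j) + (r $ i * x $ i) * c $ j + r $ i * (c $ j * y $ j))"
    by (intro sum.cong) (auto simp: algebra_simps)
  also have "\<dots> = (1 - L) * (\<Sum>i<n. r $ i * (\<Sum>j<n. c $ j)) + (\<Sum>i<n. (r $ i * x $ i) * (\<Sum>j<n. c $ j))
      + (\<Sum>i<n. r $ i * (\<Sum>j<n. c $ j * y $ j))"
    by (simp only: sum.distrib sum_distrib_left)
  also have "\<dots> = 1 - L + (\<Sum>i<n. r $ i * x $ i) + (\<Sum>j<n. c $ j * y $ j)"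
    by (simp only: c_sum r_sum flip: sum_distrib_right) simp
  finally have "1 - L + (\<Sum>i<n. r $ i * x $ i) + (\<Sum>j<n. c $ j * y $ j)
      \<le> (\<Sum>i<n. \<Sum>j<n. M (x, y) $$ (i, j))"
    using entry by (metis (no_types, lifting) lessThan_iff sum_mono)
  then show ?thesis by (simp add: s potential_def)
qed

section \<open>Decrease of the potential in one iteration\<close>

lemma marginal_error_M:
  "marginal_error r c (M s) = (\<Sum>i<n. \<bar>r $ i - rs s $ i\<bar> + \<bar>c $ i - cs s $ i\<bar>)"
  using marginal_error_eq[OF r_carrier c_carrier, of "M s"]
  by (cases s) (simp add: abs_minus_commute)

abbreviation "\<rho>r s i \<equiv> rs s $ i - r $ i + r $ i * ln (r $ i / rs s $ i)"

abbreviation "\<rho>c s j \<equiv> cs s $ j - c $ j + c $ j * ln (c $ j / cs s $ j)"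

text \<open>All marginals of a positive matrix are positive, so the infinite value of
  \<open>rho\<close> never occurs for indices below \<open>n\<close>. The step can therefore be
  stated with real numbers, with ties still broken arbitrarily.\<close>

lemma greenkhorn_step_iff:
  "greenkhorn_step n r c A (x, y) (x', y') \<longleftrightarrow>
     (\<exists>I J. is_arg_max (\<rho>r (x, y)) (\<lambda>i. i < n) I \<and> is_arg_max (\<rho>c (x, y)) (\<lambda>j. j < n) J \<and>
        (if \<rho>r (x, y) I > \<rho>c (x, y) J
         then x' = (x |\<^sub>v I \<mapsto> x $ I + ln (r $ I / rs (x, y) $ I)) \<and> y' = y
         else x' = x \<and> y' = (y |\<^sub>v J \<mapsto> y $ J + ln (c $ J / cs (x, y) $ J))))"
proof -
  let ?s = "(x, y)"
  have R: "is_arg_max (\<lambda>i. rho (r $ i) (rs ?s $ i)) (\<lambda>i. i < n) I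
      \<longleftrightarrow> is_arg_max (\<rho>r ?s) (\<lambda>i. i < n) I" for I
    using rs_pos by (auto simp: is_arg_max_def rho_pos)
  have C: "is_arg_max (\<lambda>i. rho (c $ i) (cs ?s $ i)) (\<lambda>i. i < n) J
      \<longleftrightarrow> is_arg_max (\<rho>c ?s) (\<lambda>i. i < n) J" for J
    using cs_pos by (auto simp: is_arg_max_def rho_pos)
  have "rho (r $ I) (rs ?s $ I) > rho (c $ J) (cs ?s $ J) \<longleftrightarrow> \<rho>r ?s I > \<rho>c ?s J"
    if "is_arg_max (\<rho>r ?s) (\<lambda>i. i < n) I" "is_arg_max (\<rho>c ?s) (\<lambda>j. j < n) J" for I J
    using that rs_pos cs_pos by (auto simp: is_arg_max_def rho_pos)
  then show ?thesis
    unfolding greenkhorn_step_def by (simp add: Let_def R C cong: conj_cong)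
qed

text \<open>The update minimizes the potential exactly in the coordinate \<open>x $ I\<close>: row
  \<open>I\<close> gets the sum \<open>r $ I\<close>, so the total mass changes by
  \<open>r $ I - rs (x, y) $ I\<close>, while the linear term changes by \<open>r $ I\<close> times
  the logarithm. Together these are the negated divergence.\<close>

lemma potential_row_update:
  assumes x: "x \<in> carrier_vec n" and I: "I < n"
  shows "potential ((x |\<^sub>v I \<mapsto> x $ I + ln (r $ I / rs (x, y) $ I)), y) = potential (x, y) - \<rho>r (x, y) I"
proof -
  let ?d = "ln (r $ I / rs (x, y) $ I)" let ?x = "x |\<^sub>v I \<mapsto> x $ I + ?d"
  have "exp ?d = r $ I / rs (x, y) $ I"
    using r_pos[OF I] rs_pos[OF I, of "(x, y)"] by simp
  then have entry: "M (?x, y) $$ (i, j) = (if i = I then r $ I / rs (x, y) $ I else 1) * M (x, y) $$ (i, j)"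
    if "i < n" "j < n" for i j
    using that x by (simp add: M_index exp_add)
  have *: "(\<Sum>j<n. M (?x, y) $$ (i, j)) = (if i = I then r $ I / rs (x, y) $ I else 1) * rs (x, y) $ i"
    if "i < n" for i
    using that by (simp add: entry rs_index flip: sum_distrib_left)
  have "(\<Sum>i<n. \<Sum>j<n. M (?x, y) $$ (i, j)) = (\<Sum>i<n. \<Sum>j<n. M (x, y) $$ (i, j)) + (r $ I - rs (x, y) $ I)"
    using * I rs_pos[OF I, of "(x, y)"] by (subst sum_change_one[OF I]) (auto simp: rs_index)
  moreover have "(\<Sum>i<n. r $ i * ?x $ i) = (\<Sum>i<n. r $ i * x $ i) + r $ I * ?d"
    using x I by (subst sum_change_one[OF I]) (auto simp: algebra_simps)
  ultimately show ?thesis by (simp add: potential_def)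
qed

lemma potential_col_update:
  assumes y: "y \<in> carrier_vec n" and J: "J < n"
  shows "potential (x, (y |\<^sub>v J \<mapsto> y $ J + ln (c $ J / cs (x, y) $ J))) = potential (x, y) - \<rho>c (x, y) J"
proof -
  let ?d = "ln (c $ J / cs (x, y) $ J)" let ?y = "y |\<^sub>v J \<mapsto> y $ J + ?d"
  have "exp ?d = c $ J / cs (x, y) $ J"
    using c_pos[OF J] cs_pos[OF J, of "(x, y)"] by simp
  then have entry: "M (x, ?y) $$ (i, j) = (if j = J then c $ J / cs (x, y) $ J else 1) * M (x, y) $$ (i, j)"
    if "i < n" "j < n" for i j
    using that y by (simp add: M_index exp_add)
  have *: "(\<Sum>i<n. M (x, ?y) $$ (i, j)) = (if j = J then c $ J / cs (x, y) $ J else 1) * cs (x, y) $ j"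
    if "j < n" for j
    using that by (simp add: entry cs_index flip: sum_distrib_left)
  \<comment> \<open>Summing column by column makes the change affect a single outer summand; the
    order of summation is restored afterwards.\<close>
  have "(\<Sum>j<n. \<Sum>i<n. M (x, ?y) $$ (i, j)) = (\<Sum>j<n. \<Sum>i<n. M (x, y) $$ (i, j)) + (c $ J - cs (x, y) $ J)"
    using * J cs_pos[OF J, of "(x, y)"] by (subst sum_change_one[OF J]) (auto simp: cs_index)
  then have "(\<Sum>i<n. \<Sum>j<n. M (x, ?y) $$ (i, j)) = (\<Sum>i<n. \<Sum>j<n. M (x, y) $$ (i, j)) + (c $ J - cs (x, y) $ J)"
    by (simp only: sum.swap[of "\<lambda>i j. M _ $$ (i, j)"])
  moreover have "(\<Sum>j<n. c $ j * ?y $ j) = (\<Sum>j<n. c $ j * y $ j) + c $ J * ?d"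
    using y J by (subst sum_change_one[OF J]) (auto simp: algebra_simps)
  ultimately show ?thesis by (simp add: potential_def)
qed

text \<open>Sum \<open>abs_diff_le_rho\<close> with \<open>t = \<epsilon> / 4\<close> over all rows and columns.\<close>

lemma sum_rho_lower:
  assumes err: "marginal_error r c (M s) > \<epsilon>" and "\<epsilon> \<le> 4"
  shows "\<epsilon>\<^sup>2 / 16 \<le> (\<Sum>i<n. \<rho>r s i + \<rho>c s i)"
proof -
  let ?D = "\<Sum>i<n. \<rho>r s i + \<rho>c s i" and ?k = "1 + 1 / (\<epsilon> / 4)"
  have "marginal_error r c (M s)
      \<le> (\<Sum>i<n. (?k * \<rho>r s i + \<epsilon> / 4 * r $ i) + (?k * \<rho>c s i + \<epsilon> / 4 * c $ i))"
    unfolding marginal_error_M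
    using r_pos rs_pos c_pos cs_pos eps_pos by (intro sum_mono add_mono abs_diff_le_rho) auto
  also have "\<dots> = ?k * ?D + \<epsilon> / 4 * ((\<Sum>i<n. r $ i) + (\<Sum>i<n. c $ i))"
    by (simp only: sum.distrib sum_distrib_left distrib_left add_ac)
  also have "\<dots> = ?k * ?D + \<epsilon> / 2"
    by (simp add: r_sum c_sum)
  finally have "\<epsilon> / 2 < ?k * ?D"
    using err by linarith
  also have "?k * ?D = (\<epsilon> + 4) * ?D / \<epsilon>"
    using eps_pos by (simp add: field_simps)
  finally have main: "\<epsilon>\<^sup>2 / 2 < (\<epsilon> + 4) * ?D"
    using eps_pos by (simp add: field_simps power2_eq_square)
  then have "0 < (\<epsilon> + 4) * ?D"
    using eps_pos by (smt (verit) zero_le_power2 divide_nonneg_pos)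
  then have "0 < ?D"
    using eps_pos by (simp add: zero_less_mult_iff)
  \<comment> \<open>Here \<open>\<epsilon> \<le> 4\<close> enters, and the sign of \<open>?D\<close>
    had to be settled first. The constant \<open>16\<close> is the \<open>2\<close> in
    \<open>main\<close> times this \<open>8\<close>.\<close>
  then have "(\<epsilon> + 4) * ?D \<le> 8 * ?D"
    using mult_right_mono[of "\<epsilon> + 4" 8 ?D] \<open>\<epsilon> \<le> 4\<close> by linarith
  with main show ?thesis by linarith
qed

text \<open>The constant \<open>32\<close> is the \<open>16\<close> of \<open>sum_rho_lower\<close>
  times the two families of \<open>n\<close> divergences over which the average is taken. The
  carrier conclusions allow the lemma to be iterated.\<close>

lemma greenkhorn_step_progress:
  assumes x: "x \<in> carrier_vec n" and y: "y \<in> carrier_vec n"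
    and step: "greenkhorn_step n r c A (x, y) (x', y')"
    and err: "marginal_error r c (M (x, y)) > \<epsilon>" and "\<epsilon> \<le> 4"
  shows "x' \<in> carrier_vec n" "y' \<in> carrier_vec n"
    "potential (x', y') \<le> potential (x, y) - \<epsilon>\<^sup>2 / (32 * real n)"
proof -
  let ?s = "(x, y)"
  obtain I J where I: "is_arg_max (\<rho>r ?s) (\<lambda>i. i < n) I" and J: "is_arg_max (\<rho>c ?s) (\<lambda>j. j < n) J"
    and upd: "if \<rho>r ?s I > \<rho>c ?s J
         then x' = (x |\<^sub>v I \<mapsto> x $ I + ln (r $ I / rs ?s $ I)) \<and> y' = y
         else x' = x \<and> y' = (y |\<^sub>v J \<mapsto> y $ J + ln (c $ J / cs ?s $ J))"
    using step unfolding greenkhorn_step_iff by blast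
  have lt: "I < n" "J < n" using I J by (auto simp: is_arg_max_def)
  show "x' \<in> carrier_vec n" "y' \<in> carrier_vec n"
    using upd x y by (simp_all add: update_vec_carrier split: if_splits)
  \<comment> \<open>The branch taken always updates a coordinate attaining the larger of the two
    maxima, ties included, so \<open>m\<close> is the actual drop.\<close>
  define m where "m = max (\<rho>r ?s I) (\<rho>c ?s J)"
  have "potential (x', y') = potential (x, y) - m"
    using upd potential_row_update[OF x lt(1), of y] potential_col_update[OF y lt(2), of x]
    by (auto simp: m_def max_def split: if_splits)
  moreover have "\<epsilon>\<^sup>2 / 16 \<le> 2 * real n * m"
  proof -
    have "\<epsilon>\<^sup>2 / 16 \<le> (\<Sum>i<n. \<rho>r ?s i + \<rho>c ?s i)"
      using err \<open>\<epsilon> \<le> 4\<close> by (rule sum_rho_lower)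
    also have "\<dots> \<le> (\<Sum>i<n. m + m)"
    proof (intro sum_mono add_mono)
      fix i assume "i \<in> {..<n}"
      then have "\<rho>r ?s i \<le> \<rho>r ?s I" "\<rho>c ?s i \<le> \<rho>c ?s J"
        using I J unfolding is_arg_max_linorder by blast+
      then show "\<rho>r ?s i \<le> m" "\<rho>c ?s i \<le> m"
        unfolding m_def by linarith+
    qed
    also have "\<dots> = 2 * real n * m"
      by simp
    finally show ?thesis .
  qed
  then have "\<epsilon>\<^sup>2 / (32 * real n) \<le> m"
    using n_pos by (simp add: field_simps)
  ultimately show "potential (x', y') \<le> potential (x, y) - \<epsilon>\<^sup>2 / (32 * real n)"
    by linarith
qed

section \<open>Counting the iterations\<close>

lemma marginal_error_start: "marginal_error r c (M (0\<^sub>v n, 0\<^sub>v n)) \<le> 4"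
proof -
  let ?s = "(0\<^sub>v n, 0\<^sub>v n)"
  \<comment> \<open>At the zero scaling both linear terms of the potential vanish, so its value
    \<open>1\<close> is the total mass. Hence the error is bounded by the masses of four vectors of
    sum one.\<close>
  have tot: "(\<Sum>i<n. \<Sum>j<n. M ?s $$ (i, j)) = 1"
    using potential_start by (simp add: potential_def)
  then have R: "(\<Sum>i<n. rs ?s $ i) = 1" by (simp add: rs_index)
  have C: "(\<Sum>i<n. cs ?s $ i) = 1"
    using tot by (simp add: cs_index sum.swap[of "\<lambda>i j. M _ $$ (i, j)"])
  have "marginal_error r c (M ?s) \<le> (\<Sum>i<n. (r $ i + rs ?s $ i) + (c $ i + cs ?s $ i))"
    unfolding marginal_error_M
  proof (intro sum_mono add_mono)
    fix i assume "i \<in> {..<n}"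
    then show "\<bar>r $ i - rs ?s $ i\<bar> \<le> r $ i + rs ?s $ i" "\<bar>c $ i - cs ?s $ i\<bar> \<le> c $ i + cs ?s $ i"
      using r_pos[of i] rs_pos[of i ?s] c_pos[of i] cs_pos[of i ?s] by auto
  qed
  also have "\<dots> = 4"
    by (simp add: sum.distrib r_sum c_sum R C)
  finally show ?thesis .
qed

text \<open>The \<open>k\<close> drops must fit between the starting value \<open>1\<close> and the
  lower bound \<open>1 - L\<close>. Here \<open>k\<close> is any number of iterations with error
  above the threshold, not a stopping index, so the bound also yields termination.\<close>

lemma iterations_bound:
  assumes run: "greenkhorn_run n r c A \<epsilon> st"
    and err: "\<And>l. l < k \<Longrightarrow> marginal_error r c (M (st l)) > \<epsilon>"
  shows "real k \<le> 32 * (n / \<epsilon>\<^sup>2 * L)"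
proof (cases "k = 0")
  case True
  then show ?thesis using L_nonneg by simp
next
  case False
  have st0: "st 0 = (0\<^sub>v n, 0\<^sub>v n)"
    using run by (simp add: greenkhorn_run_def)
  \<comment> \<open>An executed first iteration means that the initial error, at most
    \<open>4\<close>, exceeds \<open>\<epsilon>\<close>.\<close>
  with err[of 0] False marginal_error_start have eps4: "\<epsilon> \<le> 4" by simp
  have "fst (st m) \<in> carrier_vec n \<and> snd (st m) \<in> carrier_vec n
      \<and> potential (st m) \<le> 1 - real m * (\<epsilon>\<^sup>2 / (32 * real n))" if "m \<le> k" for m
    using that
  proof (induction m)
    case 0
    then show ?case by (simp add: st0 potential_start)
  next
    case (Suc m)
    obtain x y where xy: "st m = (x, y)" by (cases "st m")
    obtain x' y' where xy': "st (Suc m) = (x', y')" by (cases "st (Suc m)")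
    have "greenkhorn_step n r c A (x, y) (x', y')"
      using run err Suc.prems unfolding greenkhorn_run_def xy[symmetric] xy'[symmetric] by simp
    moreover have "marginal_error r c (M (x, y)) > \<epsilon>"
      using err[of m] Suc.prems xy by simp
    moreover have IH: "x \<in> carrier_vec n" "y \<in> carrier_vec n"
      "potential (x, y) \<le> 1 - real m * (\<epsilon>\<^sup>2 / (32 * real n))"
      using Suc.IH Suc.prems xy by auto
    ultimately have *: "x' \<in> carrier_vec n" "y' \<in> carrier_vec n"
      "potential (x', y') \<le> potential (x, y) - \<epsilon>\<^sup>2 / (32 * real n)"
      using greenkhorn_step_progress eps4 by blast+
    have "real (Suc m) * (\<epsilon>\<^sup>2 / (32 * real n))
        = real m * (\<epsilon>\<^sup>2 / (32 * real n)) + \<epsilon>\<^sup>2 / (32 * real n)"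
      by (simp add: distrib_right add_divide_distrib)
    then have "potential (x', y') \<le> 1 - real (Suc m) * (\<epsilon>\<^sup>2 / (32 * real n))"
      using *(3) IH(3) by linarith
    then show ?case
      using *(1,2) xy' by simp
  qed
  from this[of k] potential_lower[of "st k"] have "k * (\<epsilon>\<^sup>2 / (32 * real n)) \<le> L" by linarith
  then show ?thesis
    using n_pos eps_pos by (simp add: field_simps)
qed

text \<open>If the error stayed above \<open>\<epsilon>\<close> forever,
  \<open>iterations_bound\<close> would bound all natural numbers. The least index at which it does
  not is the stopping index.\<close>

lemma greenkhorn_terminates:
  assumes run: "greenkhorn_run n r c A \<epsilon> st"
  obtains k where "greenkhorn_output n r c A \<epsilon> st k (M (st k))" "real k \<le> 32 * (n / \<epsilon>\<^sup>2 * L)"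
    "marginal_error r c (M (st k)) \<le> \<epsilon>"
proof -
  have "\<exists>k. \<not> marginal_error r c (M (st k)) > \<epsilon>"
  proof (rule ccontr)
    assume "\<not> ?thesis"
    then have "real k \<le> 32 * (n / \<epsilon>\<^sup>2 * L)" for k
      using iterations_bound[OF run] by blast
    then show False
      by (meson not_le reals_Archimedean2)
  qed
  then obtain k where k: "\<not> marginal_error r c (M (st k)) > \<epsilon>"
    and before: "\<forall>l<k. \<not> \<not> marginal_error r c (M (st l)) > \<epsilon>"
    using exists_least_iff[of "\<lambda>k. \<not> marginal_error r c (M (st k)) > \<epsilon>"] by blast
  show thesis
  proof (rule that[of k])
    show "greenkhorn_output n r c A \<epsilon> st k (M (st k))"
      using k before unfolding greenkhorn_output_def by blast
    show "real k \<le> 32 * (n / \<epsilon>\<^sup>2 * L)"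
      using before by (intro iterations_bound[OF run]) blast
  qed (use k in linarith)
qed

end

section \<open>Running time of programs\<close>

text \<open>Weakest precondition for total correctness, with a postcondition that also sees the
  elapsed time. Determinism of \<open>exec\<close> makes the existential form lose nothing.\<close>

definition wp :: "com \<Rightarrow> (nat \<Rightarrow> ram_state \<Rightarrow> bool) \<Rightarrow> ram_state \<Rightarrow> bool" where
  "wp p Q s \<longleftrightarrow> (\<exists>t s'. exec p s t s' \<and> Q t s')"

lemma wp_exec: "exec p s t s' \<Longrightarrow> wp p Q s \<longleftrightarrow> Q t s'"
  unfolding wp_def using exec_deterministic by blast

lemmas wp_Skip [simp] = wp_exec[OF exec.Skip]
  and wp_SetReg [simp] = wp_exec[OF exec.SetReg]
  and wp_SetCell [simp] = wp_exec[OF exec.SetCell]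

lemma wp_Seq [simp]: "wp (CSeq p q) Q s \<longleftrightarrow> wp p (\<lambda>t. wp q (\<lambda>u. Q (t + u))) s"
  unfolding wp_def by (blast intro: exec.Seq elim: exec_SeqE)

lemma wp_If [simp]:
  "wp (CIf b p q) Q s \<longleftrightarrow> (if bval b s then wp p (\<lambda>t. Q (bcost b + t)) s else wp q (\<lambda>t. Q (bcost b + t)) s)"
  unfolding wp_def by (auto intro: exec.IfTrue exec.IfFalse elim!: exec_IfE)

text \<open>One unfolding of the loop; as a simplification rule it would not terminate, so it is
  applied explicitly.\<close>

lemma wp_While:
  "wp (CWhile b p) Q s \<longleftrightarrow>
    (if bval b s then wp p (\<lambda>t. wp (CWhile b p) (\<lambda>u. Q (bcost b + t + u))) s else Q (bcost b) s)"
  unfolding wp_def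
  by (auto intro: exec.WhileTrue exec.WhileFalse elim: exec_WhileE) (blast intro: exec.WhileTrue elim: exec_WhileE)

lemma wp_mono: "wp p Q s \<Longrightarrow> (\<And>t s'. Q t s' \<Longrightarrow> Q' t s') \<Longrightarrow> wp p Q' s"
  by (auto simp: wp_def)

lemma wp_SeqI:
  assumes "wp p (\<lambda>t s'. t \<le> T \<and> P s') s"
    and "\<And>s'. P s' \<Longrightarrow> wp q (\<lambda>t s''. t \<le> U \<and> Q s'') s'"
  shows "wp (CSeq p q) (\<lambda>t s'. t \<le> T + U \<and> Q s') s"
  unfolding wp_Seq
  by (rule wp_mono[OF assms(1)]) (fastforce intro: wp_mono[OF assms(2)])

section \<open>Counting loops\<close>

definition CFor :: "string \<Rightarrow> com \<Rightarrow> com" where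
  "CFor v p = CSeq (CSetReg v (NLit 0)) (CWhile (NLess (NReg v) (NReg ''n''))
     (CSeq p (CSetReg v (NAdd (NReg v) (NLit 1)))))"

text \<open>The invariant \<open>P i\<close> holds when the counter is \<open>i\<close>, and the
  body must establish \<open>P (Suc i)\<close> for the state after the increment. Each round adds
  \<open>7\<close> to the body: \<open>3\<close> for the test and \<open>4\<close> for the
  increment. The constant \<open>5\<close> is \<open>2\<close> for setting the counter and
  \<open>3\<close> for the failing test.\<close>

lemma wp_For:
  assumes "reg s ''n'' = n" "v \<noteq> ''n''" "P 0 (s\<lparr>reg := (reg s)(v := 0)\<rparr>)"
    and step: "\<And>i s. i < n \<Longrightarrow> reg s v = i \<Longrightarrow> reg s ''n'' = n \<Longrightarrow> P i s \<Longrightarrow>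
      wp p (\<lambda>t s'. t \<le> T \<and> reg s' v = i \<and> reg s' ''n'' = n \<and> P (Suc i) (s'\<lparr>reg := (reg s')(v := Suc i)\<rparr>)) s"
  shows "wp (CFor v p) (\<lambda>t s'. t \<le> 5 + n * (T + 7) \<and> P n s') s"
proof -
  let ?b = "NLess (NReg v) (NReg ''n'')" and ?p = "CSeq p (CSetReg v (NAdd (NReg v) (NLit 1)))"
  have loop: "wp (CWhile ?b ?p) (\<lambda>t s'. t \<le> 3 + (n - i) * (T + 7) \<and> P n s') s"
    if "i \<le> n" "reg s v = i" "reg s ''n'' = n" "P i s" for i s
    using that
  proof (induction "n - i" arbitrary: i s)
    case 0
    then show ?case by (subst wp_While) simp
  next
    case (Suc m)
    then have i: "i < n" and m: "n - i = Suc m" "m = n - Suc i" by auto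
    have "wp p (\<lambda>t. wp (CSetReg v (NAdd (NReg v) (NLit 1))) (\<lambda>t'. wp (CWhile ?b ?p)
        (\<lambda>u s'. bcost ?b + (t + t') + u \<le> 3 + (n - i) * (T + 7) \<and> P n s'))) s"
    proof (rule wp_mono[OF step[OF i]])
      fix t s' assume t: "t \<le> T \<and> reg s' v = i \<and> reg s' ''n'' = n \<and> P (Suc i) (s'\<lparr>reg := (reg s')(v := Suc i)\<rparr>)"
      have "wp (CWhile ?b ?p) (\<lambda>u s''. u \<le> 3 + (n - Suc i) * (T + 7) \<and> P n s'')
          (s'\<lparr>reg := (reg s')(v := Suc i)\<rparr>)"
        using m i t \<open>v \<noteq> ''n''\<close> by (intro Suc.hyps(1)) auto
      then show "wp (CSetReg v (NAdd (NReg v) (NLit 1))) (\<lambda>t'. wp (CWhile ?b ?p)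
        (\<lambda>u s'. bcost ?b + (t + t') + u \<le> 3 + (n - i) * (T + 7) \<and> P n s')) s'"
        using t m by (simp add: wp_mono)
    qed (use Suc.prems in auto)
    then show ?case
      using i Suc.prems by (subst wp_While) (simp add: add.assoc)
  qed
  show ?thesis
    unfolding CFor_def wp_Seq wp_SetReg
    apply (rule wp_mono[OF loop[of 0]])
    using assms(1-3) by auto
qed

section \<open>A program for the algorithm\<close>

abbreviation "scalar v \<equiv> Cell v (NLit 0) (NLit 0)"

abbreviation "entry v i \<equiv> Cell v (NReg i) (NLit 0)"

definition scaled_exp :: "string \<Rightarrow> string \<Rightarrow> rexp" where
  "scaled_exp u w = RMul (RMul (RExp (entry ''x'' u)) (RDiv (Cell ''A'' (NReg u) (NReg w)) (scalar ''s'')))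
     (RExp (entry ''y'' w))"

text \<open>Adding the change of a single entry of \<open>B\<close> to the stored row and column sums keeps them
  exact in constant time, whatever the entry was before.\<close>

definition refresh :: "string \<Rightarrow> string \<Rightarrow> com" where
  "refresh u w =
     CSeq (CSetCell ''t'' (NLit 0) (NLit 0) (RSub (scaled_exp u w) (Cell ''B'' (NReg u) (NReg w))))
    (CSeq (CSetCell ''R'' (NReg u) (NLit 0) (RAdd (entry ''R'' u) (scalar ''t'')))
    (CSeq (CSetCell ''K'' (NReg w) (NLit 0) (RAdd (entry ''K'' w) (scalar ''t'')))
          (CSetCell ''B'' (NReg u) (NReg w) (scaled_exp u w))))"

definition keeps :: "string set \<Rightarrow> ram_state \<Rightarrow> ram_state \<Rightarrow> bool" where
  "keeps V s s' \<longleftrightarrow> (\<forall>v. v \<notin> V \<longrightarrow> mem s' v = mem s v)"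

text \<open>Refers to the stored array \<open>B\<close> rather than to the scaled matrix, so it also
  holds while some entries are stale, and initially when everything is zero.\<close>

definition marginals :: "nat \<Rightarrow> ram_state \<Rightarrow> bool" where
  "marginals n s \<longleftrightarrow> (\<forall>i<n. mem s ''R'' i 0 = (\<Sum>j<n. mem s ''B'' i j)) \<and>
     (\<forall>j<n. mem s ''K'' j 0 = (\<Sum>i<n. mem s ''B'' i j))"

definition fresh :: "ram_state \<Rightarrow> nat \<Rightarrow> nat \<Rightarrow> bool" where
  "fresh s i j \<longleftrightarrow> mem s ''B'' i j =
     exp (mem s ''x'' i 0) * (mem s ''A'' i j / mem s ''s'' 0 0) * exp (mem s ''y'' j 0)"

abbreviation "refresh_cells \<equiv> {''t'', ''R'', ''K'', ''B''}"

lemma keeps_trans: "keeps V s s' \<Longrightarrow> keeps V s' s'' \<Longrightarrow> keeps V s s''"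
  by (auto simp: keeps_def)

lemma mem_only [simp]:
  "keeps V (s\<lparr>reg := f\<rparr>) s' \<longleftrightarrow> keeps V s s'" "keeps V s (s'\<lparr>reg := f\<rparr>) \<longleftrightarrow> keeps V s s'"
  "marginals n (s\<lparr>reg := f\<rparr>) \<longleftrightarrow> marginals n s" "fresh (s\<lparr>reg := f\<rparr>) i j \<longleftrightarrow> fresh s i j"
  by (auto simp: keeps_def marginals_def fresh_def)

text \<open>The old entry may be stale or zero, so the same code fills \<open>B\<close> initially
  and repairs it later. Freshness of the other entries survives because neither the scalings nor
  \<open>A\<close> nor the normalizing sum is written. The four assignments cost
  \<open>24 + 10 + 10 + 20 = 64\<close>.\<close>

lemma wp_refresh:
  assumes "reg s u < n" "reg s w < n" "marginals n s"
  shows "wp (refresh u w) (\<lambda>t s'. t \<le> 64 \<and> reg s' = reg s \<and> keeps refresh_cells s s' \<and> marginals n s' \<and>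
    (\<forall>p q. fresh s p q \<or> (p = reg s u \<and> q = reg s w) \<longrightarrow> fresh s' p q)) s"
proof -
  let ?i = "reg s u" and ?j = "reg s w"
  let ?e = "exp (mem s ''x'' ?i 0) * (mem s ''A'' ?i ?j / mem s ''s'' 0 0) * exp (mem s ''y'' ?j 0)"
  have row: "(\<Sum>q<n. if p = ?i \<and> q = ?j then ?e else mem s ''B'' p q)
      = (\<Sum>q<n. mem s ''B'' p q) + (if p = ?i then ?e - mem s ''B'' ?i ?j else 0)" for p
    using sum_change_one[OF assms(2), of "\<lambda>q. if p = ?i \<and> q = ?j then ?e else mem s ''B'' p q"
        "\<lambda>q. mem s ''B'' p q"] by auto
  have col: "(\<Sum>p<n. if p = ?i \<and> q = ?j then ?e else mem s ''B'' p q)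
      = (\<Sum>p<n. mem s ''B'' p q) + (if q = ?j then ?e - mem s ''B'' ?i ?j else 0)" for q
    using sum_change_one[OF assms(1), of "\<lambda>p. if p = ?i \<and> q = ?j then ?e else mem s ''B'' p q"
        "\<lambda>p. mem s ''B'' p q"] by auto
  have "wp (refresh u w) (\<lambda>t s'. t \<le> 64 \<and> reg s' = reg s \<and> keeps refresh_cells s s' \<and>
      (\<forall>p q. mem s' ''B'' p q = (if p = ?i \<and> q = ?j then ?e else mem s ''B'' p q)) \<and>
      (\<forall>p. mem s' ''R'' p 0 = mem s ''R'' p 0 + (if p = ?i then ?e - mem s ''B'' ?i ?j else 0)) \<and>
      (\<forall>q. mem s' ''K'' q 0 = mem s ''K'' q 0 + (if q = ?j then ?e - mem s ''B'' ?i ?j else 0))) s"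
    by (simp add: refresh_def scaled_exp_def keeps_def)
  then show ?thesis
  proof (rule wp_mono)
    fix t s'
    assume *: "t \<le> 64 \<and> reg s' = reg s \<and> keeps refresh_cells s s' \<and>
      (\<forall>p q. mem s' ''B'' p q = (if p = ?i \<and> q = ?j then ?e else mem s ''B'' p q)) \<and>
      (\<forall>p. mem s' ''R'' p 0 = mem s ''R'' p 0 + (if p = ?i then ?e - mem s ''B'' ?i ?j else 0)) \<and>
      (\<forall>q. mem s' ''K'' q 0 = mem s ''K'' q 0 + (if q = ?j then ?e - mem s ''B'' ?i ?j else 0))"
    then have "marginals n s'"
      using assms(3) row col unfolding marginals_def by simp
    moreover from * have "mem s' ''x'' = mem s ''x''" "mem s' ''y'' = mem s ''y''"
      "mem s' ''A'' = mem s ''A''" "mem s' ''s'' = mem s ''s''"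
      by (simp_all add: keeps_def)
    then have "fresh s' p q" if "fresh s p q \<or> (p = ?i \<and> q = ?j)" for p q
      using that * unfolding fresh_def by auto
    ultimately show "t \<le> 64 \<and> reg s' = reg s \<and> keeps refresh_cells s s' \<and> marginals n s' \<and>
      (\<forall>p q. fresh s p q \<or> (p = ?i \<and> q = ?j) \<longrightarrow> fresh s' p q)"
      using * by blast
  qed
qed

text \<open>One of the two index registers is meant to be \<open>''k''\<close>: as the second index
  it sweeps a row, as the first a column.\<close>

definition refresh_line :: "string \<Rightarrow> string \<Rightarrow> com" where
  "refresh_line u w = CFor ''k'' (refresh u w)"

text \<open>Evaluating \<open>u\<close> and \<open>w\<close> in the register file updated at
  \<open>''k''\<close> describes the visited cells uniformly for rows and columns.\<close>

lemma wp_refresh_line: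
  assumes "reg s ''n'' = n" "marginals n s"
    and bound: "\<And>m. m < n \<Longrightarrow> ((reg s)(''k'' := m)) u < n \<and> ((reg s)(''k'' := m)) w < n"
  shows "wp (refresh_line u w) (\<lambda>t s'. t \<le> 5 + n * 71 \<and> (reg s' = (reg s)(''k'' := n) \<and>
    keeps refresh_cells s s' \<and> marginals n s' \<and>
    (\<forall>p q. fresh s p q \<or> (\<exists>m<n. p = ((reg s)(''k'' := m)) u \<and> q = ((reg s)(''k'' := m)) w) \<longrightarrow> fresh s' p q))) s"
proof -
  let ?P = "\<lambda>i (s' :: ram_state). reg s' = (reg s)(''k'' := i) \<and> keeps refresh_cells s s' \<and> marginals n s' \<and>
    (\<forall>p q. fresh s p q \<or> (\<exists>m<i. p = ((reg s)(''k'' := m)) u \<and> q = ((reg s)(''k'' := m)) w) \<longrightarrow> fresh s' p q)"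
  have "wp (CFor ''k'' (refresh u w)) (\<lambda>t s'. t \<le> 5 + n * (64 + 7) \<and> ?P n s') s"
  proof (rule wp_For[where P = ?P])
    show "?P 0 (s\<lparr>reg := (reg s)(''k'' := 0)\<rparr>)"
      using assms by (simp add: keeps_def)
    fix i and s' :: ram_state assume i: "i < n" and P: "?P i s'"
    have "reg s' u < n" "reg s' w < n" "marginals n s'"
      using bound[OF i] P by auto
    then show "wp (refresh u w) (\<lambda>t s''. t \<le> 64 \<and> reg s'' ''k'' = i \<and> reg s'' ''n'' = n \<and>
        ?P (Suc i) (s''\<lparr>reg := (reg s'')(''k'' := Suc i)\<rparr>)) s'"
    proof (rule wp_mono[OF wp_refresh], goal_cases)
      case (1 t s'')
      with P have "keeps refresh_cells s s''" by (blast intro: keeps_trans)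
      moreover have "fresh s'' p q"
        if "fresh s p q \<or> (\<exists>m<Suc i. p = ((reg s)(''k'' := m)) u \<and> q = ((reg s)(''k'' := m)) w)" for p q
        using that 1 P unfolding less_Suc_eq by metis
      ultimately show ?case
        using 1 P assms(1) by simp
    qed
  qed (use assms in auto)
  then show ?thesis by (simp add: refresh_line_def)
qed

section \<open>Selecting the indices and measuring the error\<close>

definition rho_val :: "string \<Rightarrow> string \<Rightarrow> ram_state \<Rightarrow> nat \<Rightarrow> real" where
  "rho_val d m s i = mem s m i 0 - mem s d i 0 + mem s d i 0 * ln (mem s d i 0 / mem s m i 0)"

definition rho_exp :: "string \<Rightarrow> string \<Rightarrow> string \<Rightarrow> rexp" where
  "rho_exp d m i = RAdd (RSub (entry m i) (entry d i)) (RMul (entry d i) (RLog (RDiv (entry d i) (entry m i))))"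

lemma rval_rho_exp [simp]: "rval (rho_exp d m i) s = rho_val d m s (reg s i)"
  and rcost_rho_exp [simp]: "rcost (rho_exp d m i) = 20"
  by (simp_all add: rho_exp_def rho_val_def)

definition argmax :: "string \<Rightarrow> string \<Rightarrow> string \<Rightarrow> com" where
  "argmax v d m = CSeq (CSetReg v (NLit 0))
     (CFor ''k'' (CIf (RLess (rho_exp d m v) (rho_exp d m ''k'')) (CSetReg v (NReg ''k'')) CSkip))"

text \<open>A linear scan whose invariant says that \<open>v\<close> is in range and beats every
  index seen so far; starting at index \<open>0\<close> requires \<open>n > 0\<close>. A round costs
  at most \<open>41\<close> for the comparison, \<open>2\<close> for the assignment and
  \<open>7\<close> for the loop.\<close>

lemma wp_argmax:
  assumes "reg s ''n'' = n" "n > 0" "v \<notin> {''n'', ''k''}"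
  shows "wp (argmax v d m) (\<lambda>t s'. t \<le> 7 + n * 50 \<and> (mem s' = mem s \<and>
    (\<forall>w. w \<notin> {v, ''k''} \<longrightarrow> reg s' w = reg s w) \<and>
    is_arg_max (rho_val d m s) (\<lambda>i. i < n) (reg s' v))) s"
proof -
  let ?P = "\<lambda>i (s' :: ram_state). mem s' = mem s \<and> (\<forall>w. w \<notin> {v, ''k''} \<longrightarrow> reg s' w = reg s w) \<and>
    reg s' v < n \<and> (\<forall>j<i. rho_val d m s j \<le> rho_val d m s (reg s' v))"
  let ?p = "CIf (RLess (rho_exp d m v) (rho_exp d m ''k'')) (CSetReg v (NReg ''k'')) CSkip"
  have "wp (CFor ''k'' ?p) (\<lambda>t s'. t \<le> 5 + n * (43 + 7) \<and> ?P n s') (s\<lparr>reg := (reg s)(v := 0)\<rparr>)"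
  proof (rule wp_For[where P = ?P])
    fix i and s' :: ram_state assume i: "i < n" "reg s' ''k'' = i" "reg s' ''n'' = n" and P: "?P i s'"
    then have rho: "rho_val d m s' = rho_val d m s"
      by (simp add: rho_val_def fun_eq_iff)
    show "wp ?p (\<lambda>t s''. t \<le> 43 \<and> reg s'' ''k'' = i \<and> reg s'' ''n'' = n \<and>
        ?P (Suc i) (s''\<lparr>reg := (reg s'')(''k'' := Suc i)\<rparr>)) s'"
      using assms i P by (auto simp: less_Suc_eq rho)
  qed (use assms in auto)
  then show ?thesis
    unfolding argmax_def wp_Seq wp_SetReg nval.simps ncost.simps
    by (rule wp_mono) (auto simp: is_arg_max_linorder)
qed

definition add_abs :: "rexp \<Rightarrow> com" where
  "add_abs e = CIf (RLess e (RLit 0)) (CSetCell ''err'' (NLit 0) (NLit 0) (RSub (scalar ''err'') e))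
     (CSetCell ''err'' (NLit 0) (NLit 0) (RAdd (scalar ''err'') e))"

text \<open>The absolute value comes from a sign test: a negative value is subtracted, any other
  added. The expression is evaluated twice, hence the factor \<open>2\<close>.\<close>

lemma wp_add_abs:
  "wp (add_abs e) (\<lambda>t s'. t \<le> 9 + 2 * rcost e \<and> reg s' = reg s \<and> keeps {''err''} s s' \<and>
     mem s' ''err'' 0 0 = mem s ''err'' 0 0 + \<bar>rval e s\<bar>) s"
  by (simp add: add_abs_def keeps_def)

definition compute_error :: com where
  "compute_error = CSeq (CSetCell ''err'' (NLit 0) (NLit 0) (RLit 0))
     (CFor ''k'' (CSeq (add_abs (RSub (entry ''R'' ''k'') (entry ''r'' ''k'')))
        (add_abs (RSub (entry ''K'' ''k'') (entry ''c'' ''k'')))))"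

definition error :: "nat \<Rightarrow> ram_state \<Rightarrow> real" where
  "error n s = (\<Sum>i<n. \<bar>mem s ''R'' i 0 - mem s ''r'' i 0\<bar> + \<bar>mem s ''K'' i 0 - mem s ''c'' i 0\<bar>)"

lemma wp_compute_error:
  assumes "reg s ''n'' = n"
  shows "wp compute_error (\<lambda>t s'. t \<le> 9 + n * 53 \<and> (reg s' ''n'' = n \<and> keeps {''err''} s s' \<and>
    mem s' ''err'' 0 0 = error n s)) s"
proof -
  let ?p = "CSeq (add_abs (RSub (entry ''R'' ''k'') (entry ''r'' ''k'')))
        (add_abs (RSub (entry ''K'' ''k'') (entry ''c'' ''k'')))"
  let ?P = "\<lambda>i (s' :: ram_state). reg s' ''n'' = n \<and> keeps {''err''} s s' \<and> mem s' ''err'' 0 0 = error i s"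
  have "wp (CFor ''k'' ?p) (\<lambda>t s'. t \<le> 5 + n * (46 + 7) \<and> ?P n s')
    (s\<lparr>mem := (mem s)(''err'' := (mem s ''err'')(0 := (mem s ''err'' 0)(0 := 0)))\<rparr>)"
  proof (rule wp_For[where P = ?P])
    fix i and s' :: ram_state assume i: "i < n" "reg s' ''k'' = i" "reg s' ''n'' = n" and P: "?P i s'"
    have "wp ?p (\<lambda>t s''. t \<le> 23 + 23 \<and> (reg s'' = reg s' \<and> keeps {''err''} s s'' \<and>
        mem s'' ''err'' 0 0 = error (Suc i) s)) s'"
    proof (rule wp_SeqI)
      let ?e1 = "RSub (entry ''R'' ''k'') (entry ''r'' ''k'')"
      show "wp (add_abs ?e1) (\<lambda>t s''. t \<le> 23 \<and> (reg s'' = reg s' \<and> keeps {''err''} s s'' \<and>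
          mem s'' ''err'' 0 0 = error i s + \<bar>mem s ''R'' i 0 - mem s ''r'' i 0\<bar>)) s'"
        using i P by (intro wp_mono[OF wp_add_abs]) (auto simp: keeps_def)
      fix s'' assume "reg s'' = reg s' \<and> keeps {''err''} s s'' \<and>
          mem s'' ''err'' 0 0 = error i s + \<bar>mem s ''R'' i 0 - mem s ''r'' i 0\<bar>"
      then show "wp (add_abs (RSub (entry ''K'' ''k'') (entry ''c'' ''k''))) (\<lambda>t s3. t \<le> 23 \<and>
          (reg s3 = reg s' \<and> keeps {''err''} s s3 \<and> mem s3 ''err'' 0 0 = error (Suc i) s)) s''"
        using i P by (intro wp_mono[OF wp_add_abs]) (auto simp: keeps_def error_def)
    qed
    then show "wp ?p (\<lambda>t s''. t \<le> 46 \<and> reg s'' ''k'' = i \<and> reg s'' ''n'' = n \<and>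
        ?P (Suc i) (s''\<lparr>reg := (reg s'')(''k'' := Suc i)\<rparr>)) s'"
      using i P by (elim wp_mono) auto
  qed (use assms in \<open>auto simp: keeps_def error_def\<close>)
  then show ?thesis
    unfolding compute_error_def wp_Seq wp_SetCell nval.simps ncost.simps rval.simps rcost.simps of_int_0
    by (rule wp_mono) (auto simp: keeps_def)
qed

text \<open>The strict comparison with the column on the left sends ties to the column, as the
  algorithm prescribes.\<close>

definition update_scaling :: com where
  "update_scaling = CIf (RLess (rho_exp ''c'' ''K'' ''J'') (rho_exp ''r'' ''R'' ''I''))
     (CSetCell ''x'' (NReg ''I'') (NLit 0) (RAdd (entry ''x'' ''I'') (RLog (RDiv (entry ''r'' ''I'') (entry ''R'' ''I'')))))
     (CSetCell ''y'' (NReg ''J'') (NLit 0) (RAdd (entry ''y'' ''J'') (RLog (RDiv (entry ''c'' ''J'') (entry ''K'' ''J'')))))"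

definition greenkhorn_guard :: bexp where
  "greenkhorn_guard = RLess (scalar ''eps'') (scalar ''err'')"

text \<open>Both the row \<open>I\<close> and the column \<open>J\<close> are refreshed although only one of them has changed:
  the other refresh leaves \<open>B\<close> as it is.\<close>

definition greenkhorn_body :: com where
  "greenkhorn_body = CSeq (argmax ''I'' ''r'' ''R'') (CSeq (argmax ''J'' ''c'' ''K'') (CSeq update_scaling
     (CSeq (refresh_line ''I'' ''k'') (CSeq (refresh_line ''k'' ''J'') compute_error))))"

definition accumulate_entries :: com where
  "accumulate_entries = CFor ''i'' (CFor ''k'' (CSetCell ''s'' (NLit 0) (NLit 0)
     (RAdd (scalar ''s'') (Cell ''A'' (NReg ''i'') (NReg ''k'')))))"

definition greenkhorn_init :: com where
  "greenkhorn_init = CSeq accumulate_entries (CSeq (CFor ''i'' (refresh_line ''i'' ''k'')) compute_error)"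

text \<open>Induction peels off the first iteration and shifts the sequence of states. The extra
  \<open>bcost b\<close> pays for the final failing test.\<close>

lemma exec_While_iterate:
  assumes "\<And>m. m < k \<Longrightarrow> bval b (\<sigma> m) \<and> (\<exists>t. exec p (\<sigma> m) t (\<sigma> (Suc m)) \<and> real (bcost b + t) \<le> T)"
    and "\<not> bval b (\<sigma> k)"
  shows "\<exists>t. exec (CWhile b p) (\<sigma> 0) t (\<sigma> k) \<and> real t \<le> real k * T + bcost b"
  using assms
proof (induction k arbitrary: \<sigma>)
  case 0
  then show ?case using exec.WhileFalse by force
next
  case (Suc k)
  have "\<exists>t. exec (CWhile b p) (\<sigma> (Suc 0)) t (\<sigma> (Suc k)) \<and> real t \<le> real k * T + bcost b"
    using Suc.prems by (intro Suc.IH[of "\<lambda>m. \<sigma> (Suc m)"]) auto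
  then obtain u where "exec (CWhile b p) (\<sigma> (Suc 0)) u (\<sigma> (Suc k))" "real u \<le> real k * T + bcost b"
    by blast
  moreover obtain t where "exec p (\<sigma> 0) t (\<sigma> (Suc 0))" "real (bcost b + t) \<le> T" "bval b (\<sigma> 0)"
    using Suc.prems(1)[of 0] by auto
  ultimately have "exec (CWhile b p) (\<sigma> 0) (bcost b + t + u) (\<sigma> (Suc k))"
    "real (bcost b + t + u) \<le> real (Suc k) * T + bcost b"
    by (auto intro: exec.WhileTrue simp: distrib_right)
  then show ?case by blast
qed

section \<open>Reading the mathematical state off the memory\<close>

definition ram_scaling :: "nat \<Rightarrow> ram_state \<Rightarrow> scaling_state" where
  "ram_scaling n s = (vec n (\<lambda>i. mem s ''x'' i 0), vec n (\<lambda>j. mem s ''y'' j 0))"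

lemma ram_scaling_keeps:
  "keeps V s s' \<Longrightarrow> ''x'' \<notin> V \<Longrightarrow> ''y'' \<notin> V \<Longrightarrow> ram_scaling n s' = ram_scaling n s"
  by (simp add: ram_scaling_def keeps_def)

context greenkhorn
begin

text \<open>The part of the invariant that survives inside an iteration, while entries of
  \<open>B\<close> and the stored error may be out of date.\<close>

definition consistent :: "ram_state \<Rightarrow> bool" where
  "consistent s \<longleftrightarrow> reg s ''n'' = n \<and>
     (\<forall>v\<in>{''A'', ''r'', ''c'', ''eps''}. mem s v = mem (start_state n r c A \<epsilon>) v) \<and>
     mem s ''s'' 0 0 = entry_sum A \<and> marginals n s"

definition invariant :: "ram_state \<Rightarrow> bool" where
  "invariant s \<longleftrightarrow> consistent s \<and> (\<forall>i<n. \<forall>j<n. fresh s i j) \<and> mem s ''err'' 0 0 = error n s"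

lemma consistent_data:
  assumes "consistent s"
  shows "i < n \<Longrightarrow> j < n \<Longrightarrow> mem s ''A'' i j = A $$ (i, j)"
    "i < n \<Longrightarrow> mem s ''r'' i 0 = r $ i" "i < n \<Longrightarrow> mem s ''c'' i 0 = c $ i"
    "mem s ''eps'' 0 0 = \<epsilon>" "mem s ''s'' 0 0 = entry_sum A" "reg s ''n'' = n"
  using assms by (simp_all add: consistent_def start_state_def)

lemma consistent_keeps:
  assumes "consistent s" "keeps V s s'" "V \<inter> {''A'', ''r'', ''c'', ''eps'', ''s''} = {}"
    "reg s' ''n'' = n" "marginals n s'"
  shows "consistent s'"
  using assms unfolding consistent_def keeps_def by auto

lemma invariant_current_matrix:
  assumes "invariant s" "i < n" "j < n"
  shows "M (ram_scaling n s) $$ (i, j) = mem s ''B'' i j"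
  using assms consistent_data[of s]
  by (simp add: invariant_def ram_scaling_def M_index fresh_def)

lemma invariant_sums:
  assumes "invariant s" "i < n"
  shows "rs (ram_scaling n s) $ i = mem s ''R'' i 0" "cs (ram_scaling n s) $ i = mem s ''K'' i 0"
  using assms invariant_current_matrix[OF assms(1)]
  by (auto simp: rs_index cs_index invariant_def consistent_def marginals_def)

lemma invariant_rho:
  assumes "invariant s" "i < n"
  shows "rho_val ''r'' ''R'' s i = \<rho>r (ram_scaling n s) i" "rho_val ''c'' ''K'' s i = \<rho>c (ram_scaling n s) i"
  using assms invariant_sums[OF assms] consistent_data[of s]
  by (simp_all add: rho_val_def invariant_def)

lemma invariant_guard:
  assumes "invariant s"
  shows "bval greenkhorn_guard s \<longleftrightarrow> marginal_error r c (M (ram_scaling n s)) > \<epsilon>"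
proof -
  have "error n s = marginal_error r c (M (ram_scaling n s))"
    unfolding error_def marginal_error_M using assms consistent_data[of s]
    by (intro sum.cong) (auto simp: invariant_sums invariant_def abs_minus_commute)
  then show ?thesis
    using assms consistent_data[of s] by (simp add: greenkhorn_guard_def invariant_def)
qed

lemma invariant_holds:
  assumes "invariant s"
  shows "holds_scaling_state n A s (ram_scaling n s)"
proof -
  have "holds_matrix s ''B'' (M (ram_scaling n s))"
    using invariant_current_matrix[OF assms] by (simp add: holds_matrix_def)
  then show ?thesis
    by (simp add: holds_scaling_state_def ram_scaling_def holds_vector_def)
qed

text \<open>Changing one scaling coordinate makes only its own row or column stale. Claiming
  freshness just outside both row \<open>I\<close> and column \<open>J\<close> covers the two
  branches with one postcondition.\<close>

lemma wp_update_scaling: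
  assumes inv: "invariant s0" and s: "mem s = mem s0" "reg s ''n'' = n"
    and I: "is_arg_max (rho_val ''r'' ''R'' s0) (\<lambda>i. i < n) (reg s ''I'')"
    and J: "is_arg_max (rho_val ''c'' ''K'' s0) (\<lambda>j. j < n) (reg s ''J'')"
  shows "wp update_scaling (\<lambda>t s'. t \<le> 56 \<and> (reg s' = reg s \<and> consistent s' \<and>
     (\<forall>p<n. \<forall>q<n. p \<noteq> reg s ''I'' \<and> q \<noteq> reg s ''J'' \<longrightarrow> fresh s' p q) \<and>
     greenkhorn_step n r c A (ram_scaling n s0) (ram_scaling n s'))) s"
proof -
  let ?I = "reg s ''I''" and ?J = "reg s ''J''" and ?s = "ram_scaling n s0"
  have lt: "?I < n" "?J < n" using I J by (auto simp: is_arg_max_def)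
  have rho_eq: "rho_val d m s = rho_val d m s0" for d m
    by (simp add: rho_val_def fun_eq_iff s)
  have IJ: "is_arg_max (\<rho>r ?s) (\<lambda>i. i < n) ?I" "is_arg_max (\<rho>c ?s) (\<lambda>j. j < n) ?J"
    using I J lt invariant_rho[OF inv] by (simp_all add: is_arg_max_linorder)
  have cons: "consistent s0" and fresh: "\<forall>p<n. \<forall>q<n. fresh s0 p q"
    using inv by (auto simp: invariant_def)
  show ?thesis
  proof (cases "\<rho>r ?s ?I > \<rho>c ?s ?J")
    case True
    define s' where "s' = s\<lparr>mem := (mem s)(''x'' := (mem s ''x'')(?I := (mem s ''x'' ?I)
      (0 := mem s ''x'' ?I 0 + ln (mem s ''r'' ?I 0 / mem s ''R'' ?I 0))))\<rparr>"
    have k: "keeps {''x''} s0 s'" by (simp add: s'_def keeps_def s)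
    have "marginals n s'"
      using cons by (simp add: s'_def consistent_def marginals_def s)
    then have "consistent s'"
      using consistent_keeps[OF cons k] s by (simp add: s'_def)
    moreover have "\<forall>p<n. \<forall>q<n. p \<noteq> ?I \<and> q \<noteq> ?J \<longrightarrow> fresh s' p q"
      using fresh by (simp add: fresh_def s'_def s)
    moreover have "ram_scaling n s' = (fst ?s |\<^sub>v ?I \<mapsto> fst ?s $ ?I + ln (r $ ?I / rs ?s $ ?I), snd ?s)"
      using lt consistent_data[OF cons] invariant_sums[OF inv]
      by (auto simp: ram_scaling_def s'_def s update_vec_def)
    then have "greenkhorn_step n r c A ?s (ram_scaling n s')"
      using IJ True greenkhorn_step_iff[of "fst ?s" "snd ?s"] by auto
    ultimately show ?thesis
      using True invariant_rho[OF inv] lt s'_def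
      by (simp add: update_scaling_def rho_eq)
  next
    case False
    define s' where "s' = s\<lparr>mem := (mem s)(''y'' := (mem s ''y'')(?J := (mem s ''y'' ?J)
      (0 := mem s ''y'' ?J 0 + ln (mem s ''c'' ?J 0 / mem s ''K'' ?J 0))))\<rparr>"
    have k: "keeps {''y''} s0 s'" by (simp add: s'_def keeps_def s)
    have "marginals n s'"
      using cons by (simp add: s'_def consistent_def marginals_def s)
    then have "consistent s'"
      using consistent_keeps[OF cons k] s by (simp add: s'_def)
    moreover have "\<forall>p<n. \<forall>q<n. p \<noteq> ?I \<and> q \<noteq> ?J \<longrightarrow> fresh s' p q"
      using fresh by (simp add: fresh_def s'_def s)
    moreover have "ram_scaling n s' = (fst ?s, snd ?s |\<^sub>v ?J \<mapsto> snd ?s $ ?J + ln (c $ ?J / cs ?s $ ?J))"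
      using lt consistent_data[OF cons] invariant_sums[OF inv]
      by (auto simp: ram_scaling_def s'_def s update_vec_def)
    then have "greenkhorn_step n r c A ?s (ram_scaling n s')"
      using IJ False greenkhorn_step_iff[of "fst ?s" "snd ?s"] by auto
    ultimately show ?thesis
      using False invariant_rho[OF inv] lt s'_def
      by (simp add: update_scaling_def rho_eq)
  qed
qed

lemma wp_compute_error_invariant:
  assumes "consistent s" "\<forall>p<n. \<forall>q<n. fresh s p q"
  shows "wp compute_error (\<lambda>t s'. t \<le> 9 + n * 53 \<and> (invariant s' \<and> ram_scaling n s' = ram_scaling n s)) s"
proof (rule wp_mono[OF wp_compute_error[OF consistent_data(6)[OF assms(1)]]], goal_cases)
  case (1 t s')
  then have k: "keeps {''err''} s s'" and e: "mem s' ''err'' 0 0 = error n s" by auto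
  have "marginals n s'" "\<forall>p<n. \<forall>q<n. fresh s' p q" "error n s' = error n s"
    using assms k by (simp_all add: consistent_def marginals_def fresh_def error_def keeps_def)
  with 1 e show ?case
    using consistent_keeps[OF assms(1) k] ram_scaling_keeps[OF k] by (simp add: invariant_def)
qed

text \<open>The \<open>7\<close> operations left over from \<open>400 * n\<close> pay for the test of the guard.\<close>

lemma wp_greenkhorn_body:
  assumes inv: "invariant s0"
  shows "wp greenkhorn_body (\<lambda>t s'. t \<le> 400 * n - 7 \<and> (invariant s' \<and>
    greenkhorn_step n r c A (ram_scaling n s0) (ram_scaling n s'))) s0"
proof -
  have n0: "reg s0 ''n'' = n"
    using inv by (simp add: invariant_def consistent_def)
  have "wp greenkhorn_body (\<lambda>t s'. t \<le> (7 + n * 50) + ((7 + n * 50) + (56 + ((5 + n * 71) + ((5 + n * 71) + (9 + n * 53)))))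
      \<and> (invariant s' \<and> greenkhorn_step n r c A (ram_scaling n s0) (ram_scaling n s'))) s0"
    unfolding greenkhorn_body_def
  proof (intro wp_SeqI)
    show "wp (argmax ''I'' ''r'' ''R'') (\<lambda>t s'. t \<le> 7 + n * 50 \<and> (mem s' = mem s0 \<and>
        (\<forall>w. w \<notin> {''I'', ''k''} \<longrightarrow> reg s' w = reg s0 w) \<and>
        is_arg_max (rho_val ''r'' ''R'' s0) (\<lambda>i. i < n) (reg s' ''I''))) s0"
      using n0 n_pos by (intro wp_argmax) auto
  next
    fix s1 :: ram_state
    assume s1: "mem s1 = mem s0 \<and>
        (\<forall>w. w \<notin> {''I'', ''k''} \<longrightarrow> reg s1 w = reg s0 w) \<and>
        is_arg_max (rho_val ''r'' ''R'' s0) (\<lambda>i. i < n) (reg s1 ''I'')"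
    have rho: "rho_val ''c'' ''K'' s1 = rho_val ''c'' ''K'' s0"
      using s1 by (simp add: rho_val_def fun_eq_iff)
    show "wp (argmax ''J'' ''c'' ''K'') (\<lambda>t s'. t \<le> 7 + n * 50 \<and> (mem s' = mem s0 \<and> reg s' ''n'' = n \<and>
        is_arg_max (rho_val ''r'' ''R'' s0) (\<lambda>i. i < n) (reg s' ''I'') \<and>
        is_arg_max (rho_val ''c'' ''K'' s0) (\<lambda>i. i < n) (reg s' ''J''))) s1"
      using s1 n0 n_pos by (intro wp_mono[OF wp_argmax[of _ n]]) (auto simp: rho)
  next
    fix s1 s2 :: ram_state
    assume "mem s2 = mem s0 \<and> reg s2 ''n'' = n \<and>
        is_arg_max (rho_val ''r'' ''R'' s0) (\<lambda>i. i < n) (reg s2 ''I'') \<and>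
        is_arg_max (rho_val ''c'' ''K'' s0) (\<lambda>i. i < n) (reg s2 ''J'')"
    then show "wp update_scaling (\<lambda>t s'. t \<le> 56 \<and> (reg s' ''I'' < n \<and> reg s' ''J'' < n \<and> consistent s' \<and>
     (\<forall>p<n. \<forall>q<n. p \<noteq> reg s' ''I'' \<and> q \<noteq> reg s' ''J'' \<longrightarrow> fresh s' p q) \<and>
     greenkhorn_step n r c A (ram_scaling n s0) (ram_scaling n s'))) s2"
      by (intro wp_mono[OF wp_update_scaling[OF inv, of s2]]) (auto simp: is_arg_max_def)
  next
    fix s1 s2 s3 :: ram_state
    assume s3: "reg s3 ''I'' < n \<and> reg s3 ''J'' < n \<and> consistent s3 \<and>
     (\<forall>p<n. \<forall>q<n. p \<noteq> reg s3 ''I'' \<and> q \<noteq> reg s3 ''J'' \<longrightarrow> fresh s3 p q) \<and>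
     greenkhorn_step n r c A (ram_scaling n s0) (ram_scaling n s3)"
    then have c3: "consistent s3" by blast
    \<comment> \<open>Once row \<open>I\<close> is refreshed, only column \<open>J\<close> can still
      be stale; the second sweep deals with it.\<close>
    show "wp (refresh_line ''I'' ''k'') (\<lambda>t s'. t \<le> 5 + n * 71 \<and> (reg s' ''J'' < n \<and> consistent s' \<and>
     (\<forall>p<n. \<forall>q<n. q \<noteq> reg s' ''J'' \<longrightarrow> fresh s' p q) \<and>
     greenkhorn_step n r c A (ram_scaling n s0) (ram_scaling n s'))) s3"
    proof (rule wp_mono[OF wp_refresh_line[of _ n]], goal_cases)
      case (4 t s')
      then have k: "keeps refresh_cells s3 s'" by blast
      have "consistent s'"
        using consistent_keeps[OF c3 k] 4 consistent_data[OF c3] by simp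
      moreover have "ram_scaling n s' = ram_scaling n s3"
        using ram_scaling_keeps[OF k] by simp
      ultimately show ?case using 4 s3 by auto
    qed (use s3 consistent_data[OF c3] c3 in \<open>auto simp: consistent_def\<close>)
  next
    fix s1 s2 s3 s4 :: ram_state
    assume s4: "reg s4 ''J'' < n \<and> consistent s4 \<and>
     (\<forall>p<n. \<forall>q<n. q \<noteq> reg s4 ''J'' \<longrightarrow> fresh s4 p q) \<and>
     greenkhorn_step n r c A (ram_scaling n s0) (ram_scaling n s4)"
    then have c4: "consistent s4" by blast
    show "wp (refresh_line ''k'' ''J'') (\<lambda>t s'. t \<le> 5 + n * 71 \<and> (consistent s' \<and>
     (\<forall>p<n. \<forall>q<n. fresh s' p q) \<and>
     greenkhorn_step n r c A (ram_scaling n s0) (ram_scaling n s'))) s4"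
    proof (rule wp_mono[OF wp_refresh_line[of _ n]], goal_cases)
      case (4 t s')
      then have k: "keeps refresh_cells s4 s'" by blast
      have "consistent s'"
        using consistent_keeps[OF c4 k] 4 consistent_data[OF c4] by simp
      moreover have "ram_scaling n s' = ram_scaling n s4"
        using ram_scaling_keeps[OF k] by simp
      ultimately show ?case using 4 s4 by auto
    qed (use s4 consistent_data[OF c4] c4 in \<open>auto simp: consistent_def\<close>)
  next
    fix s1 s2 s3 s4 s5 :: ram_state
    assume "consistent s5 \<and> (\<forall>p<n. \<forall>q<n. fresh s5 p q) \<and>
     greenkhorn_step n r c A (ram_scaling n s0) (ram_scaling n s5)"
    then show "wp compute_error (\<lambda>t s'. t \<le> 9 + n * 53 \<and> (invariant s' \<and>
        greenkhorn_step n r c A (ram_scaling n s0) (ram_scaling n s'))) s5"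
      by (intro wp_mono[OF wp_compute_error_invariant]) auto
  qed
  \<comment> \<open>The parts add up to \<open>295 * n + 89\<close>, which is at most
    \<open>400 * n - 7\<close> for positive \<open>n\<close>.\<close>
  then show ?thesis
    by (rule wp_mono) (use n_pos in auto)
qed

section \<open>Initialization\<close>

lemma wp_accumulate_entries:
  "wp accumulate_entries (\<lambda>t s'. t \<le> 5 + n * (12 + n * 17) \<and> (consistent s' \<and>
     (\<forall>v\<in>{''x'', ''y'', ''B'', ''R'', ''K''}. mem s' v = (\<lambda>_ _. 0)))) (start_state n r c A \<epsilon>)"
proof -
  let ?s = "start_state n r c A \<epsilon>"
  let ?p = "CSetCell ''s'' (NLit 0) (NLit 0) (RAdd (scalar ''s'') (Cell ''A'' (NReg ''i'') (NReg ''k'')))"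
  let ?P = "\<lambda>i (s :: ram_state). keeps {''s''} ?s s \<and> reg s ''n'' = n \<and> mem s ''s'' 0 0 = (\<Sum>p<i. \<Sum>q<n. A $$ (p, q))"
  have "wp (CFor ''i'' (CFor ''k'' ?p)) (\<lambda>t s'. t \<le> 5 + n * ((5 + n * (10 + 7)) + 7) \<and> ?P n s') ?s"
  proof (rule wp_For[where P = ?P])
    fix i and s :: ram_state assume i: "i < n" "reg s ''i'' = i" "reg s ''n'' = n" and P: "?P i s"
    let ?Q = "\<lambda>j (s' :: ram_state). keeps {''s''} ?s s' \<and> reg s' ''i'' = i \<and> reg s' ''n'' = n \<and>
      mem s' ''s'' 0 0 = (\<Sum>p<i. \<Sum>q<n. A $$ (p, q)) + (\<Sum>q<j. A $$ (i, q))"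
    have "wp (CFor ''k'' ?p) (\<lambda>t s'. t \<le> 5 + n * (10 + 7) \<and> ?Q n s') s"
    proof (rule wp_For[where P = ?Q])
      fix j and s' :: ram_state assume j: "j < n" "reg s' ''k'' = j" "reg s' ''n'' = n" and Q: "?Q j s'"
      from Q have "mem s' ''A'' = mem ?s ''A''" by (simp add: keeps_def)
      then have "mem s' ''A'' i j = A $$ (i, j)"
        using i j by (simp add: start_state_def)
      with j Q show "wp ?p (\<lambda>t s''. t \<le> 10 \<and> reg s'' ''k'' = j \<and> reg s'' ''n'' = n \<and>
          ?Q (Suc j) (s''\<lparr>reg := (reg s'')(''k'' := Suc j)\<rparr>)) s'"
        by (simp add: keeps_def)
    qed (use i P in auto)
    then show "wp (CFor ''k'' ?p) (\<lambda>t s'. t \<le> 5 + n * (10 + 7) \<and> reg s' ''i'' = i \<and> reg s' ''n'' = n \<and>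
        ?P (Suc i) (s'\<lparr>reg := (reg s')(''i'' := Suc i)\<rparr>)) s"
      by (rule wp_mono) simp
  qed (auto simp: keeps_def start_state_def)
  then show ?thesis
    unfolding accumulate_entries_def
  proof (rule wp_mono, goal_cases)
    case (1 t s)
    then have k: "keeps {''s''} ?s s" by blast
    \<comment> \<open>Memory starts at zero, so \<open>B\<close>, \<open>R\<close> and
      \<open>K\<close> agree trivially.\<close>
    then have "marginals n s" by (simp add: marginals_def keeps_def start_state_def)
    with k 1 show ?case
      by (auto simp: consistent_def entry_sum_A keeps_def start_state_def)
  qed
qed

text \<open>Refreshing every row turns the zero array into the normalized input matrix, since
  \<open>x\<close> and \<open>y\<close> are still zero, and fills in the marginals at the same
  time.\<close>

lemma wp_greenkhorn_init:
  "wp greenkhorn_init (\<lambda>t s'. t \<le> 200 * n\<^sup>2 \<and> (invariant s' \<and> ram_scaling n s' = (0\<^sub>v n, 0\<^sub>v n)))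
     (start_state n r c A \<epsilon>)"
proof -
  have "wp greenkhorn_init (\<lambda>t s'. t \<le> (5 + n * (12 + n * 17)) + ((5 + n * ((5 + n * 71) + 7)) + (9 + n * 53)) \<and>
      (invariant s' \<and> ram_scaling n s' = (0\<^sub>v n, 0\<^sub>v n))) (start_state n r c A \<epsilon>)"
    unfolding greenkhorn_init_def
  proof (intro wp_SeqI[OF wp_accumulate_entries] wp_SeqI)
    fix s assume s: "consistent s \<and> (\<forall>v\<in>{''x'', ''y'', ''B'', ''R'', ''K''}. mem s v = (\<lambda>_ _. 0))"
    let ?P = "\<lambda>i (s' :: ram_state). consistent s' \<and> (\<forall>p<i. \<forall>q<n. fresh s' p q) \<and> keeps refresh_cells s s'"
    have cons_reg: "consistent s' \<Longrightarrow> consistent (s'\<lparr>reg := (reg s')(''i'' := i)\<rparr>)" for s' i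
      by (simp add: consistent_def)
    have "wp (CFor ''i'' (refresh_line ''i'' ''k'')) (\<lambda>t s'. t \<le> 5 + n * ((5 + n * 71) + 7) \<and> ?P n s') s"
    proof (rule wp_For[where P = ?P])
      fix i and s' :: ram_state assume i: "i < n" "reg s' ''i'' = i" "reg s' ''n'' = n" and P: "?P i s'"
      then have c': "consistent s'" by blast
      show "wp (refresh_line ''i'' ''k'') (\<lambda>t s''. t \<le> 5 + n * 71 \<and> reg s'' ''i'' = i \<and> reg s'' ''n'' = n \<and>
          ?P (Suc i) (s''\<lparr>reg := (reg s'')(''i'' := Suc i)\<rparr>)) s'"
      proof (rule wp_mono[OF wp_refresh_line[of _ n]], goal_cases)
        case (4 t s'')
        then have k: "keeps refresh_cells s' s''" by blast
        have "consistent s''"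
          using consistent_keeps[OF c' k] 4 i by simp
        moreover have "keeps refresh_cells s s''"
          using P k by (blast intro: keeps_trans)
        moreover have "\<forall>p<Suc i. \<forall>q<n. fresh s'' p q"
          using 4 i P by (auto simp: less_Suc_eq)
        ultimately have "?P (Suc i) (s''\<lparr>reg := (reg s'')(''i'' := Suc i)\<rparr>)"
          using cons_reg by simp
        then show ?case using 4 i by simp
      qed (use i c' in \<open>auto simp: consistent_def\<close>)
    qed (use s in \<open>auto simp: keeps_def consistent_def\<close>)
    then show "wp (CFor ''i'' (refresh_line ''i'' ''k'')) (\<lambda>t s'. t \<le> 5 + n * ((5 + n * 71) + 7) \<and>
        (consistent s' \<and> (\<forall>p<n. \<forall>q<n. fresh s' p q) \<and> ram_scaling n s' = (0\<^sub>v n, 0\<^sub>v n))) s"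
    proof (rule wp_mono, goal_cases)
      case (1 t s')
      then have "ram_scaling n s' = ram_scaling n s"
        using ram_scaling_keeps[of refresh_cells s s'] by simp
      also have "\<dots> = (0\<^sub>v n, 0\<^sub>v n)"
        using s by (auto simp: ram_scaling_def)
      finally show ?case using 1 by simp
    qed
  next
    fix s s' assume "consistent s' \<and> (\<forall>p<n. \<forall>q<n. fresh s' p q) \<and> ram_scaling n s' = (0\<^sub>v n, 0\<^sub>v n)"
    then show "wp compute_error (\<lambda>t s''. t \<le> 9 + n * 53 \<and> (invariant s'' \<and> ram_scaling n s'' = (0\<^sub>v n, 0\<^sub>v n))) s'"
      by (intro wp_mono[OF wp_compute_error_invariant]) auto
  qed
  moreover have "(5 + n * (12 + n * 17)) + ((5 + n * ((5 + n * 71) + 7)) + (9 + n * 53)) \<le> 200 * n\<^sup>2"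
  proof -
    \<comment> \<open>The total is \<open>88 * n\<^sup>2 + 77 * n + 19\<close>. In terms of
      \<open>m\<close> the two sides can be compared coefficient by coefficient.\<close>
    obtain m where "n = Suc m" using n_pos gr0_implies_Suc by blast
    then show ?thesis by (simp add: power2_eq_square algebra_simps)
  qed
  ultimately show ?thesis
    by (elim wp_mono) linarith
qed

text \<open>The sequence of memory states comes first, and the run is read off from it, so the
  program's own tie-breaking determines the run. The constant \<open>12800\<close> is
  \<open>32\<close> iterations' worth times \<open>400\<close> operations; \<open>207\<close> is
  \<open>200\<close> for the setup plus \<open>7\<close> for the last test.\<close>

lemma greenkhorn_program:
  obtains st k \<sigma> t where "greenkhorn_run n r c A \<epsilon> st" "greenkhorn_output n r c A \<epsilon> st k (M (st k))"
    "carries_out greenkhorn_init greenkhorn_guard greenkhorn_body n r c A \<epsilon> st k (200 * (real n)\<^sup>2) (400 * real n) \<sigma>"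
    "exec (CSeq greenkhorn_init (CWhile greenkhorn_guard greenkhorn_body)) (start_state n r c A \<epsilon>) t (\<sigma> k)"
    "holds_matrix (\<sigma> k) ''B'' (M (st k))" "marginal_error r c (M (st k)) \<le> \<epsilon>"
    "real t \<le> 207 * (real n)\<^sup>2 + 12800 * ((real n)\<^sup>2 / \<epsilon>\<^sup>2 * L)"
proof -
  obtain t0 s0 where init: "exec greenkhorn_init (start_state n r c A \<epsilon>) t0 s0" "t0 \<le> 200 * n\<^sup>2"
    "invariant s0" "ram_scaling n s0 = (0\<^sub>v n, 0\<^sub>v n)"
    using wp_greenkhorn_init by (auto simp: wp_def)
  define good where "good s s' \<longleftrightarrow> (\<exists>t. exec greenkhorn_body s t s' \<and> t \<le> 400 * n - 7) \<and> invariant s' \<and>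
    greenkhorn_step n r c A (ram_scaling n s) (ram_scaling n s')" for s s'
  \<comment> \<open>The body can be executed from every state satisfying the invariant, whatever the
    guard says, so the sequence continues past the stopping index and yields an infinite
    run.\<close>
  define \<sigma> where "\<sigma> = rec_nat s0 (\<lambda>_ s. SOME s'. good s s')"
  have \<sigma>_0: "\<sigma> 0 = s0" and \<sigma>_Suc: "\<sigma> (Suc m) = (SOME s'. good (\<sigma> m) s')" for m
    by (simp_all add: \<sigma>_def)
  have ex: "\<exists>s'. good s s'" if "invariant s" for s
    using wp_greenkhorn_body[OF that] by (auto simp: wp_def good_def)
  have inv: "invariant (\<sigma> m)" for m
  proof (induction m)
    case (Suc m)
    then show ?case using someI_ex[OF ex, of "\<sigma> m"] by (simp add: \<sigma>_Suc good_def)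
  qed (simp add: \<sigma>_0 init)
  have good: "good (\<sigma> m) (\<sigma> (Suc m))" for m
    using someI_ex[OF ex[OF inv]] by (simp add: \<sigma>_Suc)
  define st where "st m = ram_scaling n (\<sigma> m)" for m
  have run: "greenkhorn_run n r c A \<epsilon> st"
    using good by (simp add: greenkhorn_run_def st_def \<sigma>_0 init good_def)
  obtain k where k: "greenkhorn_output n r c A \<epsilon> st k (M (st k))" "real k \<le> 32 * (n / \<epsilon>\<^sup>2 * L)"
    "marginal_error r c (M (st k)) \<le> \<epsilon>"
    using greenkhorn_terminates[OF run] by blast
  have bcost: "bcost greenkhorn_guard = 7"
    by (simp add: greenkhorn_guard_def)
  have guard: "bval greenkhorn_guard (\<sigma> m) \<longleftrightarrow> marginal_error r c (M (st m)) > \<epsilon>" for m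
    using invariant_guard[OF inv] by (simp add: st_def)
  have steps: "bval greenkhorn_guard (\<sigma> m) \<and> (\<exists>t. exec greenkhorn_body (\<sigma> m) t (\<sigma> (Suc m)) \<and>
      real (bcost greenkhorn_guard + t) \<le> 400 * real n)" if "m < k" for m
  proof
    show "bval greenkhorn_guard (\<sigma> m)"
      using k(1) that guard unfolding greenkhorn_output_def by blast
    obtain t where t: "exec greenkhorn_body (\<sigma> m) t (\<sigma> (Suc m))" "t \<le> 400 * n - 7"
      using good unfolding good_def by blast
    then have "7 + t \<le> 400 * n" using n_pos by linarith
    then have "real (7 + t) \<le> real (400 * n)" by (simp only: of_nat_le_iff)
    then show "\<exists>t. exec greenkhorn_body (\<sigma> m) t (\<sigma> (Suc m)) \<and>
        real (bcost greenkhorn_guard + t) \<le> 400 * real n"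
      using t(1) bcost by auto
  qed
  have stop: "\<not> bval greenkhorn_guard (\<sigma> k)"
    using k(3) guard by simp
  have t0: "real t0 \<le> 200 * (real n)\<^sup>2"
    using of_nat_mono[OF init(2), where 'a = real] by simp
  have holds: "holds_scaling_state n A (\<sigma> m) (st m)" for m
    using invariant_holds[OF inv] by (simp add: st_def)
  then have B: "holds_matrix (\<sigma> k) ''B'' (M (st k))"
    using invariant_current_matrix[OF inv] by (simp add: holds_matrix_def st_def)
  have carries: "carries_out greenkhorn_init greenkhorn_guard greenkhorn_body n r c A \<epsilon> st k (200 * (real n)\<^sup>2) (400 * real n) \<sigma>"
    unfolding carries_out_def using init(1) t0 holds steps stop \<sigma>_0 by blast
  obtain u where u: "exec (CWhile greenkhorn_guard greenkhorn_body) (\<sigma> 0) u (\<sigma> k)"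
    "real u \<le> real k * (400 * real n) + 7"
    using exec_While_iterate[of k greenkhorn_guard \<sigma> greenkhorn_body, OF steps stop] by (auto simp: bcost)
  have "exec (CSeq greenkhorn_init (CWhile greenkhorn_guard greenkhorn_body)) (start_state n r c A \<epsilon>) (t0 + u) (\<sigma> k)"
    using init(1) u(1) by (auto intro: exec.Seq simp: \<sigma>_0)
  moreover have "real (t0 + u) \<le> 207 * (real n)\<^sup>2 + 12800 * ((real n)\<^sup>2 / \<epsilon>\<^sup>2 * L)"
  proof -
    have "real k * (400 * real n) \<le> 32 * (n / \<epsilon>\<^sup>2 * L) * (400 * real n)"
      using k(2) by (intro mult_right_mono) auto
    also have "\<dots> = 12800 * ((real n)\<^sup>2 / \<epsilon>\<^sup>2 * L)"
      by (simp add: power2_eq_square)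
    finally have "real k * (400 * real n) \<le> 12800 * ((real n)\<^sup>2 / \<epsilon>\<^sup>2 * L)" .
    moreover have "1 \<le> (real n)\<^sup>2"
      using n_pos by simp
    ultimately show ?thesis
      using t0 u(2) by linarith
  qed
  ultimately show thesis
    using that run k(1,3) carries B by blast
qed

text \<open>Absorbs the quadratic setup time into the iteration cost. For \<open>n = 1\<close> the
  sum and the minimum coincide and the rate is zero, whence \<open>2 <= n\<close>; for large
  \<open>\<epsilon>\<close> the rate becomes small, whence the cap
  \<open>\<epsilon>0\<close>.\<close>

lemma square_le_rate:
  assumes "2 \<le> n" "\<epsilon> \<le> \<epsilon>0"
  shows "(real n)\<^sup>2 \<le> \<epsilon>0\<^sup>2 * ((real n)\<^sup>2 / \<epsilon>\<^sup>2 * L)"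
proof -
  \<comment> \<open>Together with \<open>L_ge\<close> this crude bound gives
    \<open>L >= 2 * ln 2 >= 1\<close>.\<close>
  have "1 / 2 \<le> ln (2 :: real)"
    using ln_le_minus_one[of "1 / 2"] by (simp add: ln_div)
  also have "\<dots> \<le> ln (real n)"
    using assms by (intro ln_mono) auto
  finally have L: "1 \<le> L"
    using L_ge by linarith
  have "\<epsilon>\<^sup>2 \<le> \<epsilon>0\<^sup>2"
    using assms eps_pos by (intro power_mono) auto
  then have "1 \<le> \<epsilon>0\<^sup>2 / \<epsilon>\<^sup>2"
    using eps_pos by simp
  then have "1 \<le> \<epsilon>0\<^sup>2 / \<epsilon>\<^sup>2 * L"
    using L mult_mono[of 1 "\<epsilon>0\<^sup>2 / \<epsilon>\<^sup>2" 1 L] by simp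
  then have "(real n)\<^sup>2 * 1 \<le> (real n)\<^sup>2 * (\<epsilon>0\<^sup>2 / \<epsilon>\<^sup>2 * L)"
    by (intro mult_left_mono) auto
  then show ?thesis by (simp add: mult_ac)
qed

end

lemma carries_out_mono:
  assumes "carries_out init guard body n r c A \<epsilon> st k T0 T1 \<sigma>" "T0 \<le> T0'" "T1 \<le> T1'"
  shows "carries_out init guard body n r c A \<epsilon> st k T0' T1' \<sigma>"
  using assms unfolding carries_out_def by (meson order_trans)

theorem theorem3:
  shows
    "(\<exists>C>0. \<forall>n r c A \<epsilon> st.
        greenkhorn_input n r c A \<epsilon> \<longrightarrow> greenkhorn_run n r c A \<epsilon> st \<longrightarrow>
        (\<exists>k B. greenkhorn_output n r c A \<epsilon> st k B \<and>
           vec_norm1 (row_sums B - r) + vec_norm1 (col_sums B - c) \<le> \<epsilon> \<and>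
           real k \<le> C * (real n / \<epsilon>\<^sup>2 * ln (entry_sum A / min_entry A)))) \<and>
     (\<exists>init guard body. \<forall>\<epsilon>0>0. \<exists>C>0. \<forall>n r c A \<epsilon>.
        greenkhorn_input n r c A \<epsilon> \<longrightarrow>
        (\<exists>st k B \<sigma> t.
           greenkhorn_run n r c A \<epsilon> st \<and> greenkhorn_output n r c A \<epsilon> st k B \<and>
           carries_out init guard body n r c A \<epsilon> st k (C * (real n)\<^sup>2) (C * real n) \<sigma> \<and>
           exec (CSeq init (CWhile guard body)) (start_state n r c A \<epsilon>) t (\<sigma> k) \<and>
           holds_matrix (\<sigma> k) ''B'' B \<and>
           vec_norm1 (row_sums B - r) + vec_norm1 (col_sums B - c) \<le> \<epsilon> \<and>
           real t \<le> C * ((real n)\<^sup>2 + (real n)\<^sup>2 / \<epsilon>\<^sup>2 * ln (entry_sum A / min_entry A)) \<and>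
           (2 \<le> n \<and> \<epsilon> \<le> \<epsilon>0 \<longrightarrow>
              real t \<le> C * ((real n)\<^sup>2 / \<epsilon>\<^sup>2 * ln (entry_sum A / min_entry A)))))"
proof (rule conjI, goal_cases)
  case 1
  show ?case
  proof (intro exI[of _ "32 :: real"] conjI allI impI)
    fix n r c A \<epsilon> st
    assume input: "greenkhorn_input n r c A \<epsilon>" and run: "greenkhorn_run n r c A \<epsilon> st"
    interpret greenkhorn n r c A \<epsilon> using input by unfold_locales
    show "\<exists>k B. greenkhorn_output n r c A \<epsilon> st k B \<and>
           vec_norm1 (row_sums B - r) + vec_norm1 (col_sums B - c) \<le> \<epsilon> \<and>
           real k \<le> 32 * (real n / \<epsilon>\<^sup>2 * ln (entry_sum A / min_entry A))"
      using greenkhorn_terminates[OF run] unfolding marginal_error_def by blast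
  qed simp
next
  case 2
  show ?case
  proof (rule exI[of _ greenkhorn_init], rule exI[of _ greenkhorn_guard], rule exI[of _ greenkhorn_body],
      intro allI impI)
    fix \<epsilon>0 :: real assume "\<epsilon>0 > 0"
    \<comment> \<open>The first summand covers the iterations and dominates \<open>200\<close>,
      \<open>207\<close> and \<open>400\<close>; the second is the price of
      \<open>square_le_rate\<close> for the setup. Only this constant depends on
      \<open>\<epsilon>0\<close>, not the program.\<close>
    let ?C = "12800 + 207 * \<epsilon>0\<^sup>2"
    show "\<exists>C>0. \<forall>n r c A \<epsilon>.
        greenkhorn_input n r c A \<epsilon> \<longrightarrow>
        (\<exists>st k B \<sigma> t.
           greenkhorn_run n r c A \<epsilon> st \<and> greenkhorn_output n r c A \<epsilon> st k B \<and>
           carries_out greenkhorn_init greenkhorn_guard greenkhorn_body n r c A \<epsilon> st k (C * (real n)\<^sup>2) (C * real n) \<sigma> \<and>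
           exec (CSeq greenkhorn_init (CWhile greenkhorn_guard greenkhorn_body)) (start_state n r c A \<epsilon>) t (\<sigma> k) \<and>
           holds_matrix (\<sigma> k) ''B'' B \<and>
           vec_norm1 (row_sums B - r) + vec_norm1 (col_sums B - c) \<le> \<epsilon> \<and>
           real t \<le> C * ((real n)\<^sup>2 + (real n)\<^sup>2 / \<epsilon>\<^sup>2 * ln (entry_sum A / min_entry A)) \<and>
           (2 \<le> n \<and> \<epsilon> \<le> \<epsilon>0 \<longrightarrow>
              real t \<le> C * ((real n)\<^sup>2 / \<epsilon>\<^sup>2 * ln (entry_sum A / min_entry A))))"
    proof (intro exI[of _ ?C] conjI allI impI)
      fix n r c A \<epsilon> assume input: "greenkhorn_input n r c A \<epsilon>"
      interpret greenkhorn n r c A \<epsilon> using input by unfold_locales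
      let ?rate = "(real n)\<^sup>2 / \<epsilon>\<^sup>2 * ln (entry_sum A / min_entry A)"
      have rate: "0 \<le> ?rate"
        using L_nonneg by simp
      obtain st k \<sigma> t where prog: "greenkhorn_run n r c A \<epsilon> st" "greenkhorn_output n r c A \<epsilon> st k (M (st k))"
        and carries: "carries_out greenkhorn_init greenkhorn_guard greenkhorn_body n r c A \<epsilon> st k
          (200 * (real n)\<^sup>2) (400 * real n) \<sigma>"
        and exec: "exec (CSeq greenkhorn_init (CWhile greenkhorn_guard greenkhorn_body)) (start_state n r c A \<epsilon>) t (\<sigma> k)"
          "holds_matrix (\<sigma> k) ''B'' (M (st k))"
        and err: "marginal_error r c (M (st k)) \<le> \<epsilon>"
        and t: "real t \<le> 207 * (real n)\<^sup>2 + 12800 * ?rate"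
        by (rule greenkhorn_program)
      have "carries_out greenkhorn_init greenkhorn_guard greenkhorn_body n r c A \<epsilon> st k
          (?C * (real n)\<^sup>2) (?C * real n) \<sigma>"
        using carries by (rule carries_out_mono) (intro mult_right_mono; simp add: add_increasing2)+
      moreover have "real t \<le> ?C * ((real n)\<^sup>2 + ?rate)"
      proof -
        have "12800 * ((real n)\<^sup>2 + ?rate) \<le> ?C * ((real n)\<^sup>2 + ?rate)"
          using rate by (intro mult_right_mono) auto
        moreover have "207 * (real n)\<^sup>2 + 12800 * ?rate \<le> 12800 * ((real n)\<^sup>2 + ?rate)"
          by simp
        ultimately show ?thesis using t by linarith
      qed
      moreover have "real t \<le> ?C * ?rate" if "2 \<le> n \<and> \<epsilon> \<le> \<epsilon>0"
      proof -
        have "?C * ?rate = 12800 * ?rate + 207 * (\<epsilon>0\<^sup>2 * ?rate)"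
          by (simp only: distrib_right mult.assoc)
        then show ?thesis
          using t square_le_rate[of \<epsilon>0] that by linarith
      qed
      ultimately show "\<exists>st k B \<sigma> t.
           greenkhorn_run n r c A \<epsilon> st \<and> greenkhorn_output n r c A \<epsilon> st k B \<and>
           carries_out greenkhorn_init greenkhorn_guard greenkhorn_body n r c A \<epsilon> st k (?C * (real n)\<^sup>2) (?C * real n) \<sigma> \<and>
           exec (CSeq greenkhorn_init (CWhile greenkhorn_guard greenkhorn_body)) (start_state n r c A \<epsilon>) t (\<sigma> k) \<and>
           holds_matrix (\<sigma> k) ''B'' B \<and>
           vec_norm1 (row_sums B - r) + vec_norm1 (col_sums B - c) \<le> \<epsilon> \<and>
           real t \<le> ?C * ((real n)\<^sup>2 + ?rate) \<and>
           (2 \<le> n \<and> \<epsilon> \<le> \<epsilon>0 \<longrightarrow> real t \<le> ?C * ?rate)"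
        using prog exec err unfolding marginal_error_def by blast
    qed (simp add: add_pos_nonneg)
  qed
qed

end
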